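(* Let $G$ and $H$ be two non-trivial left-orderable groups. Then the space of left-preorders $\mathcal{PO}(G*H)$ of the free product $G*H$ has no isolated elements. In particular, if $G$ and $H$ are finitely generated, then $\mathcal{PO}(G*H)$ is (homeomorphic to) a Cantor set.
   Context: A left-preorder on a group $\Gamma$ is a total, transitive, reflexive binary relation $\preceq$ on $\Gamma$ that is left-invariant ($g_1\preceq g_2$ implies $gg_1\preceq gg_2$ for all $g,g_1,g_2\in\Gamma$) and non-trivial, i.e. it is not the relation in which $g_1\preceq g_2$ holds for all $g_1,g_2$. A left-order is an antisymmetric such relation; a group is left-orderable if it admits a total left-invariant order. For a left-preorder $\preceq$, the set $C=\{g: g\preceq 1 \text{ and } 1\preceq g\}$ is a proper subgroup of $\Gamma$; the positive cone is $P=\{g\in\Gamma: 1\preceq g,\ g\notin C\}$, and $\Gamma=P\sqcup P^{-1}\sqcup C$. The left-preorder is identified with the map $\phi_\preceq:\Gamma\to\{\pm1,0\}$ equal to $1$ on $P$, $-1$ on $P^{-1}$ and $0$ on $C$. $\mathcal{PO}(\Gamma)$ is the set of all (non-trivial) left-preorders on $\Gamma$, viewed as a subset of $\{\pm1,0\}^\Gamma$ and endowed with the subspace topology, where $\{\pm1,0\}$ is discrete and $\{\pm1,0\}^\Gamma$ has the product topology. *)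

theory Defs
  imports "HOL-Analysis.Analysis" "HOL-Algebra.Generated_Groups"
begin

definition left_invariant :: "('a, 'm) monoid_scheme \<Rightarrow> 'a rel \<Rightarrow> bool" where
  "left_invariant G r \<longleftrightarrow>
     (\<forall>g\<in>carrier G. \<forall>g1\<in>carrier G. \<forall>g2\<in>carrier G.
        (g1, g2) \<in> r \<longrightarrow> (g \<otimes>\<^bsub>G\<^esub> g1, g \<otimes>\<^bsub>G\<^esub> g2) \<in> r)"

definition left_orderable :: "('a, 'm) monoid_scheme \<Rightarrow> bool" where
  "left_orderable G \<longleftrightarrow> (\<exists>r. linear_order_on (carrier G) r \<and> left_invariant G r)"

definition left_preorder :: "('a, 'm) monoid_scheme \<Rightarrow> 'a rel \<Rightarrow> bool" where
  "left_preorder G r \<longleftrightarrow>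
     preorder_on (carrier G) r \<and> total_on (carrier G) r \<and> left_invariant G r \<and>
     r \<noteq> carrier G \<times> carrier G"

definition preorder_core :: "('a, 'm) monoid_scheme \<Rightarrow> 'a rel \<Rightarrow> 'a set" where
  "preorder_core G r = {g \<in> carrier G. (g, \<one>\<^bsub>G\<^esub>) \<in> r \<and> (\<one>\<^bsub>G\<^esub>, g) \<in> r}"

definition positive_cone :: "('a, 'm) monoid_scheme \<Rightarrow> 'a rel \<Rightarrow> 'a set" where
  "positive_cone G r = {g \<in> carrier G. (\<one>\<^bsub>G\<^esub>, g) \<in> r \<and> g \<notin> preorder_core G r}"

text \<open>
  Points of the product space over the index set \<^term>\<open>carrier G\<close> are extensional functions,
  hence the restricted abstraction. The last branch is the case of the core, as the group is the
  disjoint union of the positive cone, its inverse and the core.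
\<close>

definition preorder_map :: "('a, 'm) monoid_scheme \<Rightarrow> 'a rel \<Rightarrow> 'a \<Rightarrow> int" where
  "preorder_map G r =
     (\<lambda>g\<in>carrier G.
        if g \<in> positive_cone G r then 1
        else if g \<in> set_inv\<^bsub>G\<^esub> (positive_cone G r) then -1
        else 0)"

definition PO :: "('a, 'm) monoid_scheme \<Rightarrow> ('a \<Rightarrow> int) set" where
  "PO G = preorder_map G ` {r. left_preorder G r}"

definition PO_space :: "('a, 'm) monoid_scheme \<Rightarrow> ('a \<Rightarrow> int) topology" where
  "PO_space G =
     subtopology (product_topology (\<lambda>_. discrete_topology {-1, 0, 1}) (carrier G)) (PO G)"

text \<open>
  The elements of the free product are the reduced words: alternating sequences of non-identity
  elements of the two factors. Multiplication is concatenation followed by reduction;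
  \<open>fp_cons G H x w\<close> is the reduced form of \<open>x # w\<close> for a non-identity letter \<open>x\<close> and a
  reduced word \<open>w\<close>.
\<close>

definition fp_letters ::
  "('a, 'm) monoid_scheme \<Rightarrow> ('b, 'n) monoid_scheme \<Rightarrow> ('a + 'b) set" where
  "fp_letters G H = (carrier G - {\<one>\<^bsub>G\<^esub>}) <+> (carrier H - {\<one>\<^bsub>H\<^esub>})"

definition reduced_words ::
  "('a, 'm) monoid_scheme \<Rightarrow> ('b, 'n) monoid_scheme \<Rightarrow> ('a + 'b) list set" where
  "reduced_words G H =
     {w. set w \<subseteq> fp_letters G H \<and> successively (\<lambda>x y. isl x \<noteq> isl y) w}"

fun fp_cons ::
  "('a, 'm) monoid_scheme \<Rightarrow> ('b, 'n) monoid_scheme \<Rightarrow>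
   'a + 'b \<Rightarrow> ('a + 'b) list \<Rightarrow> ('a + 'b) list" where
  "fp_cons G H (Inl a) (Inl b # w) =
     (if a \<otimes>\<^bsub>G\<^esub> b = \<one>\<^bsub>G\<^esub> then w else Inl (a \<otimes>\<^bsub>G\<^esub> b) # w)"
| "fp_cons G H (Inr a) (Inr b # w) =
     (if a \<otimes>\<^bsub>H\<^esub> b = \<one>\<^bsub>H\<^esub> then w else Inr (a \<otimes>\<^bsub>H\<^esub> b) # w)"
| "fp_cons G H x w = x # w"

definition free_product ::
  "('a, 'm) monoid_scheme \<Rightarrow> ('b, 'n) monoid_scheme \<Rightarrow> ('a + 'b) list monoid" where
  "free_product G H =
     \<lparr>carrier = reduced_words G H, mult = (\<lambda>u v. foldr (fp_cons G H) u v), one = []\<rparr>"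

definition fp_inl :: "('a, 'm) monoid_scheme \<Rightarrow> 'a \<Rightarrow> ('a + 'b) list" where
  "fp_inl G a = (if a = \<one>\<^bsub>G\<^esub> then [] else [Inl a])"

definition fp_inr :: "('b, 'n) monoid_scheme \<Rightarrow> 'b \<Rightarrow> ('a + 'b) list" where
  "fp_inr H b = (if b = \<one>\<^bsub>H\<^esub> then [] else [Inr b])"

lemma reduced_words_Nil [simp]: "[] \<in> reduced_words G H"
  by (simp add: reduced_words_def)

lemma reduced_words_Cons:
  "x # w \<in> reduced_words G H \<longleftrightarrow>
     x \<in> fp_letters G H \<and> w \<in> reduced_words G H \<and> (w = [] \<or> isl x \<noteq> isl (hd w))"
  by (cases w) (auto simp: reduced_words_def)

lemma fp_letters_simps [simp]:
  "Inl a \<in> fp_letters G H \<longleftrightarrow> a \<in> carrier G \<and> a \<noteq> \<one>\<^bsub>G\<^esub>"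
  "Inr b \<in> fp_letters G H \<longleftrightarrow> b \<in> carrier H \<and> b \<noteq> \<one>\<^bsub>H\<^esub>"
  by (auto simp: fp_letters_def)

locale group_pair = G: group G + H: group H
  for G :: "('a, 'm) monoid_scheme" and H :: "('b, 'n) monoid_scheme"
begin

lemma fp_cons_closed:
  assumes "x \<in> fp_letters G H" "w \<in> reduced_words G H"
  shows "fp_cons G H x w \<in> reduced_words G H"
proof (cases w)
  case (Cons y w')
  thus ?thesis
    using assms by (cases x; cases y) (auto simp: reduced_words_Cons)
qed (use assms in \<open>auto simp: reduced_words_Cons\<close>)

lemma foldr_fp_cons_closed:
  assumes "set u \<subseteq> fp_letters G H" "v \<in> reduced_words G H"
  shows "foldr (fp_cons G H) u v \<in> reduced_words G H"
  using assms by (induction u) (auto intro: fp_cons_closed)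

lemma fp_cons_Inl:
  assumes "Inl a \<in> fp_letters G H" "Inl b \<in> fp_letters G H" "w \<in> reduced_words G H"
  shows "fp_cons G H (Inl a) (fp_cons G H (Inl b) w) =
           (if a \<otimes>\<^bsub>G\<^esub> b = \<one>\<^bsub>G\<^esub> then w else fp_cons G H (Inl (a \<otimes>\<^bsub>G\<^esub> b)) w)"
proof (cases "\<exists>c w'. w = Inl c # w'")
  case True
  then obtain c w' where w: "w = Inl c # w'" by blast
  have c: "c \<in> carrier G" "c \<noteq> \<one>\<^bsub>G\<^esub>" and ab: "a \<in> carrier G" "b \<in> carrier G" "a \<noteq> \<one>\<^bsub>G\<^esub>"
    using assms w by (auto simp: reduced_words_Cons)
  have w': "fp_cons G H (Inl a) w' = Inl a # w'"
    using assms(3) w by (cases w'; cases "hd w'") (auto simp: reduced_words_Cons)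
  have assoc: "a \<otimes>\<^bsub>G\<^esub> (b \<otimes>\<^bsub>G\<^esub> c) = a \<otimes>\<^bsub>G\<^esub> b \<otimes>\<^bsub>G\<^esub> c"
    using ab c by (simp add: G.m_assoc)
  show ?thesis
  proof (cases "b \<otimes>\<^bsub>G\<^esub> c = \<one>\<^bsub>G\<^esub>")
    case True
    hence abc: "a \<otimes>\<^bsub>G\<^esub> b \<otimes>\<^bsub>G\<^esub> c = a"
      using assoc ab by simp
    have "a \<otimes>\<^bsub>G\<^esub> b \<noteq> \<one>\<^bsub>G\<^esub> \<or> a = c"
      using abc c by auto
    thus ?thesis using True w w' abc ab by auto
  next
    case False
    thus ?thesis using w assoc c by auto
  qed
next
  case False
  have "fp_cons G H (Inl x) w = Inl x # w" for x
  proof (cases w)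
    case (Cons y ys)
    thus ?thesis using False by (cases y) auto
  qed simp
  thus ?thesis by simp
qed

lemma fp_cons_Inr:
  assumes "Inr a \<in> fp_letters G H" "Inr b \<in> fp_letters G H" "w \<in> reduced_words G H"
  shows "fp_cons G H (Inr a) (fp_cons G H (Inr b) w) =
           (if a \<otimes>\<^bsub>H\<^esub> b = \<one>\<^bsub>H\<^esub> then w else fp_cons G H (Inr (a \<otimes>\<^bsub>H\<^esub> b)) w)"
proof (cases "\<exists>c w'. w = Inr c # w'")
  case True
  then obtain c w' where w: "w = Inr c # w'" by blast
  have c: "c \<in> carrier H" "c \<noteq> \<one>\<^bsub>H\<^esub>" and ab: "a \<in> carrier H" "b \<in> carrier H" "a \<noteq> \<one>\<^bsub>H\<^esub>"
    using assms w by (auto simp: reduced_words_Cons)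
  have w': "fp_cons G H (Inr a) w' = Inr a # w'"
    using assms(3) w by (cases w'; cases "hd w'") (auto simp: reduced_words_Cons)
  have assoc: "a \<otimes>\<^bsub>H\<^esub> (b \<otimes>\<^bsub>H\<^esub> c) = a \<otimes>\<^bsub>H\<^esub> b \<otimes>\<^bsub>H\<^esub> c"
    using ab c by (simp add: H.m_assoc)
  show ?thesis
  proof (cases "b \<otimes>\<^bsub>H\<^esub> c = \<one>\<^bsub>H\<^esub>")
    case True
    hence abc: "a \<otimes>\<^bsub>H\<^esub> b \<otimes>\<^bsub>H\<^esub> c = a"
      using assoc ab by simp
    have "a \<otimes>\<^bsub>H\<^esub> b \<noteq> \<one>\<^bsub>H\<^esub> \<or> a = c"
      using abc c by auto
    thus ?thesis using True w w' abc ab by auto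
  next
    case False
    thus ?thesis using w assoc c by auto
  qed
next
  case False
  have "fp_cons G H (Inr x) w = Inr x # w" for x
  proof (cases w)
    case (Cons y ys)
    thus ?thesis using False by (cases y) auto
  qed simp
  thus ?thesis by simp
qed

lemma foldr_fp_cons:
  assumes "x \<in> fp_letters G H" "u \<in> reduced_words G H" "v \<in> reduced_words G H"
  shows "foldr (fp_cons G H) (fp_cons G H x u) v = fp_cons G H x (foldr (fp_cons G H) u v)"
proof (cases u)
  case (Cons y u')
  have y: "y \<in> fp_letters G H" and "set u' \<subseteq> fp_letters G H"
    using assms(2) Cons by (auto simp: reduced_words_Cons reduced_words_def)
  hence v': "foldr (fp_cons G H) u' v \<in> reduced_words G H"
    using assms(3) foldr_fp_cons_closed by blast
  show ?thesis
    using Cons fp_cons_Inl[OF _ _ v'] fp_cons_Inr[OF _ _ v'] assms(1) y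
    by (cases x; cases y) auto
qed simp

lemma foldr_fp_cons_assoc:
  assumes "set u \<subseteq> fp_letters G H" "v \<in> reduced_words G H" "w \<in> reduced_words G H"
  shows "foldr (fp_cons G H) (foldr (fp_cons G H) u v) w =
           foldr (fp_cons G H) u (foldr (fp_cons G H) v w)"
  using assms by (induction u) (auto simp: foldr_fp_cons foldr_fp_cons_closed)

lemma foldr_fp_cons_Nil:
  assumes "w \<in> reduced_words G H"
  shows "foldr (fp_cons G H) w [] = w"
  using assms
proof (induction w)
  case (Cons x w)
  thus ?case
    by (cases x; cases w; cases "hd w") (auto simp: reduced_words_Cons)
qed simp

lemma reduced_words_letters: "w \<in> reduced_words G H \<Longrightarrow> set w \<subseteq> fp_letters G H"
  by (simp add: reduced_words_def)

lemma reduced_words_left_inverse: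
  assumes "w \<in> reduced_words G H"
  shows "\<exists>v\<in>reduced_words G H. foldr (fp_cons G H) v w = []"
  using assms
proof (induction w)
  case Nil
  thus ?case by (intro bexI[of _ "[]"]) auto
next
  case (Cons x w)
  then obtain v where v: "v \<in> reduced_words G H" "foldr (fp_cons G H) v w = []"
    by (auto simp: reduced_words_Cons)
  obtain y where y: "y \<in> fp_letters G H" "fp_cons G H y (x # w) = w"
  proof (cases x)
    case (Inl a)
    with Cons.prems show ?thesis
      by (intro that[of "Inl (inv\<^bsub>G\<^esub> a)"]) (auto simp: reduced_words_Cons)
  next
    case (Inr b)
    with Cons.prems show ?thesis
      by (intro that[of "Inr (inv\<^bsub>H\<^esub> b)"]) (auto simp: reduced_words_Cons)
  qed
  have yr: "[y] \<in> reduced_words G H"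
    using y by (simp add: reduced_words_Cons)
  have "foldr (fp_cons G H) (foldr (fp_cons G H) v [y]) (x # w) = []"
    using foldr_fp_cons_assoc[OF reduced_words_letters[OF v(1)] yr Cons.prems] v y by simp
  thus ?case
    using foldr_fp_cons_closed[OF reduced_words_letters[OF v(1)] yr] by blast
qed

lemma group_free_product: "group (free_product G H)"
proof (rule groupI)
  fix x assume "x \<in> carrier (free_product G H)"
  thus "\<exists>y\<in>carrier (free_product G H). y \<otimes>\<^bsub>free_product G H\<^esub> x = \<one>\<^bsub>free_product G H\<^esub>"
    using reduced_words_left_inverse by (simp add: free_product_def)
qed (auto simp: free_product_def foldr_fp_cons_closed reduced_words_letters foldr_fp_cons_assoc)

lemma fp_inl_hom: "fp_inl G \<in> hom G (free_product G H)"
  by (rule homI) (auto simp: fp_inl_def free_product_def reduced_words_Cons)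

lemma fp_inr_hom: "fp_inr H \<in> hom H (free_product G H)"
  by (rule homI) (auto simp: fp_inr_def free_product_def reduced_words_Cons)

lemma free_product_universal_existence:
  assumes K: "group K" and f: "f \<in> hom G K" and g: "g \<in> hom H K"
  shows "\<exists>h\<in>hom (free_product G H) K.
           (\<forall>a\<in>carrier G. h (fp_inl G a) = f a) \<and> (\<forall>b\<in>carrier H. h (fp_inr H b) = g b)"
proof -
  interpret K: group K by (rule K)
  interpret f: group_hom G K f using f by unfold_locales
  interpret g: group_hom H K g using g by unfold_locales
  define ev where "ev x = (case x of Inl a \<Rightarrow> f a | Inr b \<Rightarrow> g b)" for x
  define h where "h w = foldr (\<lambda>x k. ev x \<otimes>\<^bsub>K\<^esub> k) w \<one>\<^bsub>K\<^esub>" for w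
  have h_simps [simp]: "h [] = \<one>\<^bsub>K\<^esub>" "h (x # w) = ev x \<otimes>\<^bsub>K\<^esub> h w" for x w
    by (auto simp: h_def)
  have ev [simp]: "ev (Inl a) = f a" "ev (Inr b) = g b" for a b
    by (auto simp: ev_def)
  have ev_closed: "ev x \<in> carrier K" if "x \<in> fp_letters G H" for x
    using that by (cases x) auto
  have h_closed: "h w \<in> carrier K" if "set w \<subseteq> fp_letters G H" for w
    using that by (induction w) (auto intro: ev_closed)
  have cons: "h (fp_cons G H x w) = ev x \<otimes>\<^bsub>K\<^esub> h w"
    if "x \<in> fp_letters G H" "w \<in> reduced_words G H" for x w
  proof (cases w)
    case (Cons y w')
    have y: "y \<in> fp_letters G H" and w': "h w' \<in> carrier K"
      using that Cons h_closed by (auto simp: reduced_words_Cons reduced_words_def)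
    show ?thesis
    proof (cases x; cases y)
      fix a b assume xy: "x = Inl a" "y = Inl b"
      have "f a \<otimes>\<^bsub>K\<^esub> (f b \<otimes>\<^bsub>K\<^esub> h w') = f (a \<otimes>\<^bsub>G\<^esub> b) \<otimes>\<^bsub>K\<^esub> h w'"
        using that y w' xy by (simp add: K.m_assoc)
      thus ?thesis using Cons xy w' by (auto simp del: f.hom_mult)
    next
      fix a b assume xy: "x = Inr a" "y = Inr b"
      have "g a \<otimes>\<^bsub>K\<^esub> (g b \<otimes>\<^bsub>K\<^esub> h w') = g (a \<otimes>\<^bsub>H\<^esub> b) \<otimes>\<^bsub>K\<^esub> h w'"
        using that y w' xy by (simp add: K.m_assoc)
      thus ?thesis using Cons xy w' by (auto simp del: g.hom_mult)
    qed (use Cons in auto)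
  qed simp
  have mult: "h (foldr (fp_cons G H) u v) = h u \<otimes>\<^bsub>K\<^esub> h v"
    if "set u \<subseteq> fp_letters G H" "v \<in> reduced_words G H" for u v
    using that
  proof (induction u)
    case Nil
    thus ?case using h_closed[OF reduced_words_letters] by simp
  next
    case (Cons x u)
    thus ?case
      using cons[of x "foldr (fp_cons G H) u v"] foldr_fp_cons_closed[of u v]
        h_closed[of u] h_closed[OF reduced_words_letters[of v]] ev_closed[of x]
      by (simp add: K.m_assoc)
  qed
  have "h \<in> hom (free_product G H) K"
    by (rule homI) (auto simp: free_product_def h_closed reduced_words_letters mult)
  thus ?thesis
    by (intro bexI[of _ h]) (auto simp: fp_inl_def fp_inr_def)
qed

lemma free_product_universal_uniqueness:
  assumes h: "h \<in> hom (free_product G H) K" and h': "h' \<in> hom (free_product G H) K"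
    and l: "\<And>a. a \<in> carrier G \<Longrightarrow> h (fp_inl G a) = h' (fp_inl G a)"
    and r: "\<And>b. b \<in> carrier H \<Longrightarrow> h (fp_inr H b) = h' (fp_inr H b)"
    and w: "w \<in> carrier (free_product G H)"
  shows "h w = h' w"
proof -
  have "w \<in> reduced_words G H" using w by (simp add: free_product_def)
  thus ?thesis
  proof (induction w)
    case Nil
    show ?case using l[of "\<one>\<^bsub>G\<^esub>"] by (simp add: fp_inl_def)
  next
    case (Cons x w)
    have x: "x \<in> fp_letters G H" and w: "w \<in> carrier (free_product G H)"
      using Cons.prems by (auto simp: reduced_words_Cons free_product_def)
    have x': "[x] \<in> carrier (free_product G H)"
      using x by (simp add: free_product_def reduced_words_Cons)
    have eq: "x # w = [x] \<otimes>\<^bsub>free_product G H\<^esub> w"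
      using foldr_fp_cons_Nil[OF Cons.prems] foldr_fp_cons_Nil[of w] Cons.prems
      by (simp add: free_product_def reduced_words_Cons)
    have "h [x] = h' [x]"
    proof (cases x)
      case (Inl a)
      thus ?thesis using x l[of a] by (simp add: fp_inl_def)
    next
      case (Inr b)
      thus ?thesis using x r[of b] by (simp add: fp_inr_def)
    qed
    moreover have "h w = h' w"
      using Cons by (simp add: reduced_words_Cons)
    ultimately show ?case
      using hom_mult[OF h x' w] hom_mult[OF h' x' w] by (simp add: eq)
  qed
qed

end

definition finitely_generated :: "('a, 'm) monoid_scheme \<Rightarrow> bool" where
  "finitely_generated G \<longleftrightarrow> (\<exists>S. finite S \<and> S \<subseteq> carrier G \<and> generate G S = carrier G)"

definition isolated_point_of :: "'a topology \<Rightarrow> 'a \<Rightarrow> bool" where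
  "isolated_point_of X x \<longleftrightarrow> x \<in> topspace X \<and> openin X {x}"

fun cantor_stage :: "nat \<Rightarrow> real set" where
  "cantor_stage 0 = {0..1}"
| "cantor_stage (Suc n) =
     (\<lambda>x. x / 3) ` cantor_stage n \<union> (\<lambda>x. (x + 2) / 3) ` cantor_stage n"

definition cantor_set :: "real set" where
  "cantor_set = (\<Inter>n. cantor_stage n)"

end

theory Submission
  imports Defs
begin

text \<open>
  A left-preorder is its sign function \<open>\<phi>\<close>. Let \<open>F\<close> be a finite set of words closed under
  suffixes, \<open>m\<close> its largest element for the preorder of \<open>\<phi>\<close>, and \<open>k\<close> a letter, say from \<open>G\<close>,
  that moves \<open>m\<close> upwards; such a letter exists, since otherwise the preorder would be trivial. Both
  factors act on the group, ordered by \<open>\<phi>\<close>, and by freeness the two actions can be changed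
  independently. Keeping the \<open>G\<close>-action, and the \<open>H\<close>-action as far as it is visible on \<open>F\<close>, one
  prescribes whether \<open>H\<close> fixes or moves the point \<open>k m\<close>, which lies above \<open>F\<close>; the left-order of
  \<open>H\<close> makes moving possible. The opposite of what \<open>\<phi>\<close> does yields a preorder different from \<open>\<phi>\<close>
  that has the same signs on \<open>F\<close>.

  The two actions are glued by an order isomorphism extending a prescribed finite one. For countable
  groups this is Cantor's back-and-forth argument, after embedding the ordered sets into the
  rationals. By compactness of the space of sign functions it suffices to satisfy finitely many
  conditions at a time, which involve only countable subgroups of the two factors.

  If the factors are finitely generated, non-triviality of a preorder is a closed condition, so the
  space is compact, and Brouwer's characterization of the Cantor set applies.
\<close>

subsection \<open>Order automorphisms of the rationals\<close>

text \<open>No value of \<phi> can be changed alone, since the axioms tie all values together. The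
  way out is that every action \<rho> on the rationals with a base point q gives a preorder, by
  comparing \<rho> g q with q; so it suffices to change an action. A word acts through its letters
  from the right, hence the base point travels through the suffixes of the word. This is why F has
  to be closed under suffixes, and why the signs on F depend on the letters at finitely many points
  only. The word that detects the change is inv (k m) b (k m), with b in the factor other than that
  of k: its sign tells which way b moves k m. To prescribe this sign, a fresh copy of the factor of
  b, ordered by a chosen sign function \<sigma>, is placed above the whole old ordered set, and its
  identity is given the position of k m. Being above F is the only order relation that this requires
  of k m.\<close>

definition order_aut :: "(rat \<Rightarrow> rat) monoid" where
  "order_aut = \<lparr>carrier = {f. strict_mono f \<and> surj f}, mult = (\<circ>), one = id\<rparr>"

lemma order_aut_simps [simp]:
  "f \<in> carrier order_aut \<longleftrightarrow> strict_mono f \<and> surj f"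
  "f \<otimes>\<^bsub>order_aut\<^esub> g = f \<circ> g"
  "\<one>\<^bsub>order_aut\<^esub> = id"
  by (auto simp: order_aut_def)

lemma group_order_aut: "group order_aut"
proof (rule groupI)
  fix f assume "f \<in> carrier order_aut"
  hence f: "strict_mono f" "surj f" by auto
  have "strict_mono (inv_into UNIV f)"
  proof (rule strict_monoI)
    fix x y :: rat assume "x < y"
    then show "inv_into UNIV f x < inv_into UNIV f y"
      using f strict_mono_less[OF f(1)] by (metis surj_f_inv_f)
  qed
  moreover have "surj (inv_into UNIV f)"
    using f by (simp add: inj_imp_surj_inv strict_mono_imp_inj_on)
  moreover have "inv_into UNIV f \<circ> f = id"
    using f by (simp add: strict_mono_imp_inj_on)
  ultimately show "\<exists>g\<in>carrier order_aut. g \<otimes>\<^bsub>order_aut\<^esub> f = \<one>\<^bsub>order_aut\<^esub>"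
    by (intro bexI[of _ "inv_into UNIV f"]) auto
next
  fix f g assume "f \<in> carrier order_aut" "g \<in> carrier order_aut"
  then show "f \<otimes>\<^bsub>order_aut\<^esub> g \<in> carrier order_aut"
    using comp_surj[of g f] by (auto simp: strict_mono_def)
qed (auto simp: strict_mono_def comp_assoc)

lemma rat_between:
  fixes L U :: "rat set"
  assumes "finite L" "finite U" "\<And>l u. l \<in> L \<Longrightarrow> u \<in> U \<Longrightarrow> l < u"
  shows "\<exists>q. (\<forall>l\<in>L. l < q) \<and> (\<forall>u\<in>U. q < u)"
proof (cases "L = {} \<or> U = {}")
  case True
  moreover have "\<exists>q. \<forall>u\<in>U. q < u"
  proof (cases "U = {}")
    case False
    obtain q where "q < Min U" using lt_ex by blast
    then show ?thesis using False assms by (intro exI[of _ q]) auto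
  qed auto
  moreover have "\<exists>q. \<forall>l\<in>L. l < q"
  proof (cases "L = {}")
    case False
    obtain q where "Max L < q" using gt_ex by blast
    then show ?thesis using False assms by (intro exI[of _ q]) auto
  qed auto
  ultimately show ?thesis by auto
next
  case False
  then have "Max L < Min U" using assms by auto
  then obtain q where "Max L < q" "q < Min U" using dense by blast
  then show ?thesis using False assms by (intro exI[of _ q]) auto
qed

subsection \<open>Cantor's isomorphism theorem for preorders\<close>

text \<open>Antisymmetry is left out on purpose: a non-trivial core makes distinct group elements
  equivalent, and the group acts on elements rather than on classes.\<close>

locale total_preorder =
  fixes X :: "'x set" and prec :: "'x \<Rightarrow> 'x \<Rightarrow> bool"
  assumes total: "x \<in> X \<Longrightarrow> y \<in> X \<Longrightarrow> prec x y \<or> prec y x"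
    and trans: "x \<in> X \<Longrightarrow> y \<in> X \<Longrightarrow> z \<in> X \<Longrightarrow> prec x y \<Longrightarrow> prec y z \<Longrightarrow> prec x z"
begin

lemma refl: "x \<in> X \<Longrightarrow> prec x x"
  using total by blast

lemma ex_greatest:
  assumes "finite L" "L \<noteq> {}" "L \<subseteq> X"
  shows "\<exists>m\<in>L. \<forall>l\<in>L. prec l m"
  using assms
proof (induction L rule: finite_ne_induct)
  case (singleton x)
  then show ?case using refl by auto
next
  case (insert x L)
  then obtain m where m: "m \<in> L" "\<forall>l\<in>L. prec l m" by auto
  show ?case
  proof (cases "prec m x")
    case True
    then show ?thesis
      using m insert.prems refl by (intro bexI[of _ x]) (auto intro: trans[of _ m x])
  next
    case False
    then show ?thesis
      using m insert.prems total[of m x] by (intro bexI[of _ m]) auto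
  qed
qed

lemma dual: "total_preorder X (\<lambda>x y. prec y x)"
  using total trans by unfold_locales blast+

end

text \<open>A partial isomorphism in the back-and-forth argument. The equivalence makes P
  single-valued up to nothing and injective up to equivalence: two pairs have the same rational
  exactly if their points are equivalent.\<close>

definition order_matching :: "('x \<Rightarrow> 'x \<Rightarrow> bool) \<Rightarrow> ('x \<times> rat) set \<Rightarrow> bool" where
  "order_matching prec P \<longleftrightarrow> (\<forall>(x, q)\<in>P. \<forall>(y, r)\<in>P. prec x y \<longleftrightarrow> q \<le> r)"

lemma order_matchingD:
  "order_matching prec P \<Longrightarrow> (x, q) \<in> P \<Longrightarrow> (y, r) \<in> P \<Longrightarrow> prec x y \<longleftrightarrow> q \<le> r"
  by (auto simp: order_matching_def)

locale dense_preorder = total_preorder +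
  assumes dense: "x \<in> X \<Longrightarrow> y \<in> X \<Longrightarrow> \<not> prec y x \<Longrightarrow> \<exists>z\<in>X. \<not> prec z x \<and> \<not> prec y z"
    and no_top: "x \<in> X \<Longrightarrow> \<exists>y\<in>X. \<not> prec y x"
    and no_bot: "x \<in> X \<Longrightarrow> \<exists>y\<in>X. \<not> prec x y"
    and nonempty: "X \<noteq> {}"
begin

lemma between:
  assumes "finite L" "finite U" "L \<subseteq> X" "U \<subseteq> X" "\<And>l u. l \<in> L \<Longrightarrow> u \<in> U \<Longrightarrow> \<not> prec u l"
  shows "\<exists>x\<in>X. (\<forall>l\<in>L. \<not> prec x l) \<and> (\<forall>u\<in>U. \<not> prec u x)"
proof -
  interpret D: total_preorder X "\<lambda>x y. prec y x" by (rule dual)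
  have L: "\<exists>m\<in>L. \<forall>l\<in>L. prec l m" if "L \<noteq> {}" using ex_greatest that assms by blast
  have U: "\<exists>m\<in>U. \<forall>u\<in>U. prec m u" if "U \<noteq> {}" using D.ex_greatest that assms by blast
  consider "L = {}" "U = {}" | "L \<noteq> {}" "U = {}" | "L = {}" "U \<noteq> {}" | "L \<noteq> {}" "U \<noteq> {}"
    by blast
  then show ?thesis
  proof cases
    case 1 then show ?thesis using nonempty by auto
  next
    case 2
    then obtain m where m: "m \<in> L" "\<forall>l\<in>L. prec l m" using L by blast
    then obtain y where "y \<in> X" "\<not> prec y m" using no_top assms by blast
    then show ?thesis using 2 m assms(3) trans[of y _ m] by blast
  next
    case 3
    then obtain m where m: "m \<in> U" "\<forall>l\<in>U. prec m l" using U by blast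
    then obtain y where "y \<in> X" "\<not> prec m y" using no_bot assms by blast
    then show ?thesis using 3 m assms(4) trans[of m _ y] by blast
  next
    case 4
    obtain m where m: "m \<in> L" "\<forall>l\<in>L. prec l m" using L 4 by blast
    obtain n where n: "n \<in> U" "\<forall>l\<in>U. prec n l" using U 4 by blast
    obtain z where z: "z \<in> X" "\<not> prec z m" "\<not> prec n z" using dense[of m n] m n assms by blast
    have "\<not> prec z l" if "l \<in> L" for l
      using that z m assms(3) trans[of z l m] by blast
    moreover have "\<not> prec u z" if "u \<in> U" for u
      using that z n assms(4) trans[of n u z] by blast
    ultimately show ?thesis using z(1) by blast
  qed
qed

text \<open>A point equivalent to one already matched must take the same rational. Otherwise x is
  strictly comparable with every matched point, so the rationals of the points below it lie strictly
  below those of the points above it.\<close>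

lemma forth_step:
  assumes P: "finite P" "P \<subseteq> X \<times> UNIV" "order_matching prec P" and x: "x \<in> X"
  shows "\<exists>q. order_matching prec (insert (x, q) P)"
proof (cases "\<exists>(y, r)\<in>P. prec x y \<and> prec y x")
  case True
  then obtain y r where y: "(y, r) \<in> P" "prec x y" "prec y x" by auto
  have yX: "y \<in> X" using y P by auto
  have eq: "prec x z \<longleftrightarrow> prec y z" "prec z x \<longleftrightarrow> prec z y" if "z \<in> X" for z
    using y x yX that trans[of x y z] trans[of y x z] trans[of z x y] trans[of z y x] by blast+
  have "(prec x z \<longleftrightarrow> r \<le> s) \<and> (prec z x \<longleftrightarrow> s \<le> r)" if "(z, s) \<in> P" for z s
  proof -
    have "z \<in> X" using that P by auto
    then show ?thesis
      using eq[of z] order_matchingD[OF P(3) y(1) that] order_matchingD[OF P(3) that y(1)] by simp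
  qed
  then have "order_matching prec (insert (x, r) P)"
    using P(3) refl[OF x] by (auto simp: order_matching_def)
  then show ?thesis ..
next
  case False
  define L where "L = {r. \<exists>y. (y, r) \<in> P \<and> prec y x}"
  define U where "U = {r. \<exists>y. (y, r) \<in> P \<and> prec x y}"
  have "finite L" "finite U"
    by (rule finite_subset[OF _ finite_imageI[OF P(1), of snd]], force simp: L_def U_def)+
  moreover have "l < u" if lu: "l \<in> L" "u \<in> U" for l u
  proof -
    obtain y z where yz: "(y, l) \<in> P" "prec y x" "(z, u) \<in> P" "prec x z" 
      using lu by (auto simp: L_def U_def)
    have "\<not> prec z y"
      using yz False P x trans[of z y x] by blast
    then show ?thesis using order_matchingD[OF P(3) yz(3,1)] by simp
  qed
  ultimately obtain q where q: "\<forall>l\<in>L. l < q" "\<forall>u\<in>U. q < u" using rat_between by blast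
  have "(prec x y \<longleftrightarrow> q \<le> r) \<and> (prec y x \<longleftrightarrow> r \<le> q)" if "(y, r) \<in> P" for y r
  proof (cases "prec x y")
    case True
    then have "\<not> prec y x" using False that by blast
    moreover have "q < r" using q True that by (auto simp: U_def)
    ultimately show ?thesis using True by auto
  next
    case F: False
    then have "prec y x" using total x P that by blast
    moreover have "r < q" using q \<open>prec y x\<close> that by (auto simp: L_def)
    ultimately show ?thesis using F by auto
  qed
  then have "order_matching prec (insert (x, q) P)"
    using P(3) refl[OF x] by (auto simp: order_matching_def)
  then show ?thesis ..
qed

text \<open>The mirror image of \<open>forth_step\<close>, with density and absence of endpoints of
  X in place of those of the rationals.\<close>

lemma back_step:
  assumes P: "finite P" "P \<subseteq> X \<times> UNIV" "order_matching prec P"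
  shows "\<exists>x\<in>X. order_matching prec (insert (x, q) P)"
proof (cases "\<exists>y. (y, q) \<in> P")
  case True
  then obtain y where "(y, q) \<in> P" by blast
  then show ?thesis using P by (intro bexI[of _ y]) (auto simp: insert_absorb)
next
  case False
  define L where "L = {y. \<exists>r. (y, r) \<in> P \<and> r < q}"
  define U where "U = {y. \<exists>r. (y, r) \<in> P \<and> q < r}"
  have "finite L" "finite U"
    by (rule finite_subset[OF _ finite_imageI[OF P(1), of fst]], force simp: L_def U_def)+
  moreover have "\<not> prec u l" if lu: "l \<in> L" "u \<in> U" for l u
  proof -
    obtain r s where "(l, r) \<in> P" "r < q" "(u, s) \<in> P" "q < s"
      using lu by (auto simp: L_def U_def)
    then show ?thesis using order_matchingD[OF P(3), of u s l r] by simp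
  qed
  moreover have "L \<subseteq> X" "U \<subseteq> X" using P(2) by (auto simp: L_def U_def)
  ultimately obtain x where x: "x \<in> X" "\<forall>l\<in>L. \<not> prec x l" "\<forall>u\<in>U. \<not> prec u x" 
    using between[of L U] by auto
  have "(prec x y \<longleftrightarrow> q \<le> r) \<and> (prec y x \<longleftrightarrow> r \<le> q)" if "(y, r) \<in> P" for y r
  proof -
    have "r < q \<or> q < r" "y \<in> X" using that False P(2) by (auto simp: neq_iff[symmetric])
    then have "r < q \<and> y \<in> L \<or> q < r \<and> y \<in> U" using that by (auto simp: L_def U_def)
    then show ?thesis using x total[of x y] \<open>y \<in> X\<close> by auto
  qed
  then have "order_matching prec (insert (x, q) P)"
    using P(3) refl[OF x(1)] by (auto simp: order_matching_def)
  then show ?thesis using x by blast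
qed

text \<open>Back-and-forth along enumerations of X and of the rationals. The resulting f is onto but
  collapses equivalent points. Starting from a finite matching \<open>P0\<close> instead of the
  empty one is what later allows automorphisms with prescribed finitely many values.\<close>

theorem cantor_isomorphism:
  assumes "countable X" and P0: "finite P0" "P0 \<subseteq> X \<times> UNIV" "order_matching prec P0"
  shows "\<exists>f::_ \<Rightarrow> rat. f ` X = UNIV \<and> (\<forall>x\<in>X. \<forall>y\<in>X. f x \<le> f y \<longleftrightarrow> prec x y) \<and>
           (\<forall>(x, q)\<in>P0. f x = q)"
proof -
  define good where "good P \<longleftrightarrow> finite P \<and> P \<subseteq> X \<times> UNIV \<and> order_matching prec P \<and> P0 \<subseteq> P" for P
  have step: "\<exists>P'. good P' \<and> P \<subseteq> P' \<and> from_nat_into X n \<in> fst ` P' \<and> from_nat_into UNIV n \<in> snd ` P'"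
    if "good P" for P and n
  proof -
    let ?x = "from_nat_into X n" and ?q = "from_nat_into (UNIV :: rat set) n"
    have x: "?x \<in> X" using nonempty by (rule from_nat_into)
    obtain q where q: "order_matching prec (insert (?x, q) P)"
      using forth_step[of P ?x] x \<open>good P\<close> by (auto simp: good_def)
    obtain y where y: "y \<in> X" "order_matching prec (insert (y, ?q) (insert (?x, q) P))"
      using back_step[of "insert (?x, q) P" ?q] q x \<open>good P\<close> by (auto simp: good_def)
    show ?thesis
      using x y \<open>good P\<close>
      by (intro exI[of _ "insert (y, ?q) (insert (?x, q) P)"]) (auto simp: good_def)
  qed
  have "good P0" using P0 by (simp add: good_def)
  then have "\<exists>P. \<forall>n. good (P n) \<and> (P n \<subseteq> P (Suc n) \<and> from_nat_into X n \<in> fst ` P (Suc n) \<and>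
              from_nat_into UNIV n \<in> snd ` P (Suc n))"
    using step by (intro dependent_nat_choice) auto
  then obtain P where P: "\<And>n. good (P n)" "\<And>n. P n \<subseteq> P (Suc n)"
    "\<And>n. from_nat_into X n \<in> fst ` P (Suc n)"
    "\<And>n. from_nat_into (UNIV :: rat set) n \<in> snd ` P (Suc n)" by blast
  have mono: "P i \<subseteq> P j" if "i \<le> j" for i j
    using lift_Suc_mono_le[of P] P(2) that by blast
  define R where "R = (\<Union>n. P n)"
  have RX: "R \<subseteq> X \<times> UNIV" using P(1) by (auto simp: R_def good_def)
  have R: "prec x y \<longleftrightarrow> q \<le> r" if xy: "(x, q) \<in> R" "(y, r) \<in> R" for x q y r
  proof -
    obtain i j where ij: "(x, q) \<in> P i" "(y, r) \<in> P j" using xy by (auto simp: R_def)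
    then have "(x, q) \<in> P (max i j)" "(y, r) \<in> P (max i j)"
      using mono[of i "max i j"] mono[of j "max i j"] by auto
    then show ?thesis using P(1)[of "max i j"] unfolding good_def by (meson order_matchingD)
  qed
  have ex: "\<exists>q. (x, q) \<in> R" if x: "x \<in> X" for x
  proof -
    obtain n where "from_nat_into X n = x" using from_nat_into_surj[OF assms(1) x] by blast
    then show ?thesis using P(3)[of n] by (force simp: R_def)
  qed
  have ex': "\<exists>x. (x, q) \<in> R" for q
  proof -
    obtain n where "from_nat_into UNIV n = q" using from_nat_into_surj[of "UNIV :: rat set" q] by auto
    then show ?thesis using P(4)[of n] by (force simp: R_def)
  qed
  define f where "f x = (SOME q. (x, q) \<in> R)" for x
  have fR: "(x, f x) \<in> R" if "x \<in> X" for x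
    unfolding f_def using ex[OF that] by (rule someI_ex)
  have f_eq: "f x = q" if "(x, q) \<in> R" for x q
  proof -
    have "x \<in> X" using that RX by auto
    then show ?thesis
      using R[OF that fR] R[OF fR that] refl[of x] by (auto intro: antisym)
  qed
  show ?thesis
  proof (intro exI[of _ f] conjI ballI)
    have "q \<in> f ` X" for q
    proof -
      obtain x where x: "(x, q) \<in> R" using ex' by blast
      then have "x \<in> X" using RX by blast
      then show ?thesis using f_eq[OF x] by blast
    qed
    then show "f ` X = UNIV" by blast
    show "f x \<le> f y \<longleftrightarrow> prec x y" if "x \<in> X" "y \<in> X" for x y
      using R fR that by blast
    show "case xq of (x, q) \<Rightarrow> f x = q" if "xq \<in> P0" for xq
    proof -
      have "P0 \<subseteq> R" using P(1)[of 0] by (auto simp: good_def R_def)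
      then show ?thesis using that f_eq by auto
    qed
  qed
qed

end

lemma dense_preorder_rat: "dense_preorder UNIV ((\<le>) :: rat \<Rightarrow> rat \<Rightarrow> bool)"
  by unfold_locales (auto simp: not_le intro: dense gt_ex lt_ex)

text \<open>The hypothesis says that the pairs (f x, g x) form a finite matching of the rationals
  with themselves, from which the back-and-forth can start.\<close>

lemma order_aut_extension:
  fixes f g :: "'x \<Rightarrow> rat"
  assumes "finite F" and "\<And>x y. x \<in> F \<Longrightarrow> y \<in> F \<Longrightarrow> f x \<le> f y \<longleftrightarrow> g x \<le> g y"
  shows "\<exists>h\<in>carrier order_aut. \<forall>x\<in>F. h (f x) = g x"
proof -
  interpret dense_preorder UNIV "(\<le>) :: rat \<Rightarrow> rat \<Rightarrow> bool" by (rule dense_preorder_rat)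
  have "order_matching (\<le>) ((\<lambda>x. (f x, g x)) ` F)"
    using assms(2) by (auto simp: order_matching_def)
  then obtain h :: "rat \<Rightarrow> rat" where h: "surj h" "\<forall>x y. h x \<le> h y \<longleftrightarrow> x \<le> y" "\<forall>x\<in>F. h (f x) = g x"
    using cantor_isomorphism[of "(\<lambda>x. (f x, g x)) ` F"] assms(1) by auto
  have "strict_mono h"
    using h(2) by (auto intro!: strict_monoI simp: not_le[symmetric])
  then show ?thesis using h by auto
qed

subsection \<open>Realizing actions on the rationals\<close>

locale preorder_action = total_preorder X prec + group B
  for X :: "'x set" and prec and B (structure) +
  fixes act :: "'b \<Rightarrow> 'x \<Rightarrow> 'x"
  assumes act_closed: "b \<in> carrier B \<Longrightarrow> x \<in> X \<Longrightarrow> act b x \<in> X"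
    and act_one: "x \<in> X \<Longrightarrow> act \<one> x = x"
    and act_mult: "b \<in> carrier B \<Longrightarrow> c \<in> carrier B \<Longrightarrow> x \<in> X \<Longrightarrow> act (b \<otimes> c) x = act b (act c x)"
    and act_le: "b \<in> carrier B \<Longrightarrow> x \<in> X \<Longrightarrow> y \<in> X \<Longrightarrow> prec x y \<Longrightarrow> prec (act b x) (act b y)"
begin

lemma act_le_iff:
  assumes "b \<in> carrier B" "x \<in> X" "y \<in> X"
  shows "prec (act b x) (act b y) \<longleftrightarrow> prec x y"
proof
  assume "prec (act b x) (act b y)"
  then have "prec (act (inv b) (act b x)) (act (inv b) (act b y))"
    using assms by (simp add: act_le act_closed)
  moreover have "act (inv b) (act b z) = z" if "z \<in> X" for z
    using assms(1) that act_mult[of "inv b" b z] act_one[OF that] by (metis inv_closed l_inv)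
  ultimately show "prec x y" using assms by simp
qed (use assms act_le in blast)

text \<open>X may have gaps, jumps and endpoints, so it is first thickened: every equivalence class
  is replaced by a copy of the rationals. The lexicographic result is dense without endpoints, hence
  a copy of the rationals by Cantor's theorem, and the action on the first coordinate carries
  over.\<close>

theorem rational_realization:
  assumes "countable X" "X \<noteq> {}"
  obtains \<beta> pos where "\<beta> \<in> hom B order_aut"
    and "\<And>x y. x \<in> X \<Longrightarrow> y \<in> X \<Longrightarrow> pos x \<le> pos y \<longleftrightarrow> prec x y"
    and "\<And>b x. b \<in> carrier B \<Longrightarrow> x \<in> X \<Longrightarrow> \<beta> b (pos x) = pos (act b x)"
proof -
  \<comment> \<open>The rational coordinate decides only between equivalent points, so that
    equivalent points share one fibre.\<close>
  define lex where "lex = (\<lambda>(x, q::rat) (y, r). prec x y \<and> (prec y x \<longrightarrow> q \<le> r))"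
  interpret L: dense_preorder "X \<times> UNIV" lex
  proof unfold_locales
    fix u v assume uv: "u \<in> X \<times> (UNIV :: rat set)" "v \<in> X \<times> (UNIV :: rat set)"
    then show "lex u v \<or> lex v u" using total by (fastforce simp: lex_def)
    show "lex u w" if "w \<in> X \<times> UNIV" "lex u v" "lex v w" for w
    proof -
      obtain x q y r z t where eq: "u = (x, q)" "v = (y, r)" "w = (z, t)"
        by (cases u, cases v, cases w) blast
      then have X: "x \<in> X" "y \<in> X" "z \<in> X" using uv that by auto
      have "prec x z" using that eq X trans[of x y z] by (auto simp: lex_def)
      moreover have "q \<le> t" if "prec z x"
        using that eq X \<open>lex u v\<close> \<open>lex v w\<close> trans[of z x y] trans[of y z x] by (auto simp: lex_def)
      ultimately show ?thesis using eq by (simp add: lex_def)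
    qed
    show "\<exists>z\<in>X \<times> UNIV. \<not> lex z u \<and> \<not> lex v z" if nle: "\<not> lex v u"
    proof -
      obtain x q y r where eq: "u = (x, q)" "v = (y, r)" by force
      show ?thesis
      proof (cases "prec y x")
        case True
        then have "q < r" "prec x y" using nle eq by (auto simp: lex_def)
        then obtain s where "q < s" "s < r" using Orderings.dense by blast
        then show ?thesis using uv eq True \<open>prec x y\<close> refl
          by (intro bexI[of _ "(x, s)"]) (auto simp: lex_def)
      next
        case False
        obtain s where "q < s" using gt_ex by blast
        then show ?thesis using uv eq False refl
          by (intro bexI[of _ "(x, s)"]) (auto simp: lex_def)
      qed
    qed
  next
    fix u assume u: "u \<in> X \<times> (UNIV :: rat set)"
    obtain x q where eq: "u = (x, q)" by force
    obtain s t where "q < s" "t < q" using gt_ex lt_ex by blast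
    then have "\<not> lex (x, s) u" "\<not> lex u (x, t)" "(x, s) \<in> X \<times> UNIV" "(x, t) \<in> X \<times> UNIV"
      using u eq refl by (auto simp: lex_def)
    then show "\<exists>v\<in>X \<times> UNIV. \<not> lex v u" "\<exists>v\<in>X \<times> UNIV. \<not> lex u v" by blast+
  qed (use assms in auto)
  obtain f where f: "f ` (X \<times> UNIV) = (UNIV :: rat set)"
      "\<And>u v. u \<in> X \<times> UNIV \<Longrightarrow> v \<in> X \<times> UNIV \<Longrightarrow> f u \<le> f v \<longleftrightarrow> lex u v"
    using L.cantor_isomorphism[of "{}"] assms(1) by (auto simp: order_matching_def)
  have f_eq: "f u = f v \<longleftrightarrow> lex u v \<and> lex v u" if "u \<in> X \<times> UNIV" "v \<in> X \<times> UNIV" for u v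
    using f(2) that by (metis order_antisym order_refl)
  have lex_act: "lex (act b x, q) (act b y, r) \<longleftrightarrow> lex (x, q) (y, r)"
    if "b \<in> carrier B" "x \<in> X" "y \<in> X" for b x y q r
    using that act_le_iff by (simp add: lex_def)
  have "\<exists>u. u \<in> X \<times> UNIV \<and> f u = q" for q
    using f(1) by (metis UNIV_I imageE)
  then obtain g where g: "\<And>q. g q \<in> X \<times> UNIV" "\<And>q. f (g q) = q" by metis
  \<comment> \<open>\<open>g\<close> picks a representative of each rational. As \<open>f\<close> is
    not injective, independence of this choice has to be proved; it holds because the action
    preserves equivalence and leaves the fibre coordinate alone.\<close>
  define \<beta> where "\<beta> b q = f (act b (fst (g q)), snd (g q))" for b q
  have \<beta>: "\<beta> b (f (x, q)) = f (act b x, q)" if "b \<in> carrier B" "x \<in> X" for b x q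
  proof -
    obtain y r where yr: "g (f (x, q)) = (y, r)" by force
    have yX: "y \<in> X" using g(1)[of "f (x, q)"] yr by auto
    have "f (y, r) = f (x, q)" using g(2)[of "f (x, q)"] yr by simp
    then have "f (act b y, r) = f (act b x, q)"
      using that yX act_closed by (simp add: f_eq lex_act)
    then show ?thesis by (simp add: \<beta>_def yr)
  qed
  have f_surj: "\<exists>x r. x \<in> X \<and> q = f (x, r)" for q
    using g[of q] by (metis mem_Times_iff prod.collapse)
  have "\<beta> \<in> hom B order_aut"
  proof (rule homI)
    fix b assume b: "b \<in> carrier B"
    have "strict_mono (\<beta> b)"
    proof (rule strict_monoI)
      fix p q :: rat assume "p < q"
      obtain x r where x: "x \<in> X" "p = f (x, r)" using f_surj by blast
      obtain y s where y: "y \<in> X" "q = f (y, s)" using f_surj by blast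
      have "\<not> lex (y, s) (x, r)" using f(2)[of "(y, s)" "(x, r)"] x y \<open>p < q\<close> by auto
      then have "\<not> \<beta> b q \<le> \<beta> b p"
        using x y b by (simp add: \<beta> f(2) act_closed lex_act)
      then show "\<beta> b p < \<beta> b q" by simp
    qed
    moreover have "surj (\<beta> b)"
      unfolding surj_def
    proof
      fix q
      obtain x r where x: "x \<in> X" "q = f (x, r)" using f_surj by blast
      then have "\<beta> b (f (act (inv b) x, r)) = q"
        using b act_closed act_mult[of b "inv b", symmetric] by (simp add: \<beta> act_one)
      then show "\<exists>p. q = \<beta> b p" by metis
    qed
    ultimately show "\<beta> b \<in> carrier order_aut" by simp
  next
    fix b c assume bc: "b \<in> carrier B" "c \<in> carrier B"
    show "\<beta> (b \<otimes> c) = \<beta> b \<otimes>\<^bsub>order_aut\<^esub> \<beta> c"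
    proof
      fix q
      obtain x r where x: "x \<in> X" "q = f (x, r)" using f_surj by blast
      then show "\<beta> (b \<otimes> c) q = (\<beta> b \<otimes>\<^bsub>order_aut\<^esub> \<beta> c) q"
        using bc by (simp add: \<beta> act_mult act_closed)
    qed
  qed
  \<comment> \<open>The points with fibre coordinate 0 form a copy of X inside the rationals that
    the action respects; any other fixed coordinate would do.\<close>
  moreover have "f (x, 0) \<le> f (y, 0) \<longleftrightarrow> prec x y" if "x \<in> X" "y \<in> X" for x y
    using that f(2) by (auto simp: lex_def)
  ultimately show ?thesis using \<beta>
    by (intro that[of \<beta> "\<lambda>x. f (x, 0)"]) auto
qed

end

subsection \<open>Sign functions\<close>

lemma (in group) cancel_inv:
  assumes "x \<in> carrier G" "y \<in> carrier G"
  shows "inv x \<otimes> (x \<otimes> y) = y" "x \<otimes> (inv x \<otimes> y) = y"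
  using assms by (simp_all flip: m_assoc)

definition sign_fun :: "('g, 'k) monoid_scheme \<Rightarrow> ('g \<Rightarrow> int) \<Rightarrow> bool" where
  "sign_fun K \<phi> \<longleftrightarrow>
     (\<forall>g\<in>carrier K. \<phi> g \<in> {-1, 0, 1}) \<and>
     (\<forall>g\<in>carrier K. \<forall>h\<in>carrier K.
        (g \<otimes>\<^bsub>K\<^esub> h = \<one>\<^bsub>K\<^esub> \<longrightarrow> \<phi> h = - \<phi> g) \<and>
        (0 \<le> \<phi> g \<longrightarrow> 0 \<le> \<phi> h \<longrightarrow> 0 \<le> \<phi> (g \<otimes>\<^bsub>K\<^esub> h)))"

lemma sign_fun_zero: "sign_fun K (\<lambda>_. 0)"
  by (simp add: sign_fun_def)

locale signed_group = group \<Gamma> for \<Gamma> (structure) +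
  fixes \<phi> :: "'g \<Rightarrow> int"
  assumes sign: "sign_fun \<Gamma> \<phi>"
begin

lemma sign_range: "g \<in> carrier \<Gamma> \<Longrightarrow> \<phi> g = -1 \<or> \<phi> g = 0 \<or> \<phi> g = 1"
  using sign by (auto simp: sign_fun_def)

lemma sign_inv: "g \<in> carrier \<Gamma> \<Longrightarrow> \<phi> (inv g) = - \<phi> g"
  using sign unfolding sign_fun_def by (metis inv_closed r_inv)

lemma sign_mult: "g \<in> carrier \<Gamma> \<Longrightarrow> h \<in> carrier \<Gamma> \<Longrightarrow> 0 \<le> \<phi> g \<Longrightarrow> 0 \<le> \<phi> h \<Longrightarrow> 0 \<le> \<phi> (g \<otimes> h)"
  using sign by (simp add: sign_fun_def)

lemma sign_one: "\<phi> \<one> = 0"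
  using sign_inv[of \<one>] by simp

definition below :: "'g \<Rightarrow> 'g \<Rightarrow> bool" where
  "below x y \<longleftrightarrow> 0 \<le> \<phi> (inv x \<otimes> y)"

lemma sign_swap: "x \<in> carrier \<Gamma> \<Longrightarrow> y \<in> carrier \<Gamma> \<Longrightarrow> \<phi> (inv y \<otimes> x) = - \<phi> (inv x \<otimes> y)"
  using sign_inv[of "inv x \<otimes> y"] by (simp add: inv_mult_group)

lemma sign_eq_below:
  assumes "x \<in> carrier \<Gamma>" "y \<in> carrier \<Gamma>"
  shows "\<phi> (inv x \<otimes> y) = (if \<not> below y x then 1 else if \<not> below x y then -1 else 0)"
  using sign_swap[OF assms] sign_range[of "inv x \<otimes> y"] assms by (auto simp: below_def)

lemma below_mult:
  assumes "g \<in> carrier \<Gamma>" "x \<in> carrier \<Gamma>" "y \<in> carrier \<Gamma>"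
  shows "below (g \<otimes> x) (g \<otimes> y) \<longleftrightarrow> below x y"
proof -
  have "inv (g \<otimes> x) \<otimes> (g \<otimes> y) = inv x \<otimes> y"
    using assms by (simp add: inv_mult_group m_assoc cancel_inv)
  then show ?thesis by (simp add: below_def)
qed

lemma below_total_preorder: "total_preorder (carrier \<Gamma>) below"
proof
  fix x y z assume x: "x \<in> carrier \<Gamma>" and y: "y \<in> carrier \<Gamma>"
  then show "below x y \<or> below y x"
    using sign_swap[of x y] by (auto simp: below_def)
  assume z: "z \<in> carrier \<Gamma>" and le: "below x y" "below y z"
  have "inv x \<otimes> y \<otimes> (inv y \<otimes> z) = inv x \<otimes> z"
    using x y z by (simp add: m_assoc cancel_inv)
  then show "below x z"
    using sign_mult[of "inv x \<otimes> y" "inv y \<otimes> z"] x y z le by (simp add: below_def)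
qed

lemma sign_mult_zero:
  assumes "g \<in> carrier \<Gamma>" "h \<in> carrier \<Gamma>" "\<phi> g = 0" "\<phi> h = 0"
  shows "\<phi> (g \<otimes> h) = 0"
  using sign_mult[of g h] sign_mult[of "inv h" "inv g"] assms
  by (simp add: sign_inv flip: inv_mult_group)

text \<open>This is the stabilizer of the equivalence class of x under left multiplication, since
  the sign of inv x g x compares g x with x.\<close>

lemma conjugate_core_subgroup:
  assumes x: "x \<in> carrier \<Gamma>"
  shows "subgroup {g \<in> carrier \<Gamma>. \<phi> (inv x \<otimes> g \<otimes> x) = 0} \<Gamma>"
proof (rule subgroupI)
  show "{g \<in> carrier \<Gamma>. \<phi> (inv x \<otimes> g \<otimes> x) = 0} \<noteq> {}"
    using x sign_one by (auto intro!: exI[of _ \<one>])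
next
  fix g assume "g \<in> {g \<in> carrier \<Gamma>. \<phi> (inv x \<otimes> g \<otimes> x) = 0}"
  then show "inv g \<in> {g \<in> carrier \<Gamma>. \<phi> (inv x \<otimes> g \<otimes> x) = 0}"
    using x sign_inv[of "inv x \<otimes> g \<otimes> x"] by (auto simp: inv_mult_group m_assoc)
next
  fix g h
  assume g: "g \<in> {g \<in> carrier \<Gamma>. \<phi> (inv x \<otimes> g \<otimes> x) = 0}"
    and h: "h \<in> {g \<in> carrier \<Gamma>. \<phi> (inv x \<otimes> g \<otimes> x) = 0}"
  have "inv x \<otimes> (g \<otimes> h) \<otimes> x = inv x \<otimes> g \<otimes> x \<otimes> (inv x \<otimes> h \<otimes> x)"
    using g h x by (simp add: m_assoc cancel_inv)
  then show "g \<otimes> h \<in> {g \<in> carrier \<Gamma>. \<phi> (inv x \<otimes> g \<otimes> x) = 0}"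
    using g h x sign_mult_zero[of "inv x \<otimes> g \<otimes> x" "inv x \<otimes> h \<otimes> x"] by simp
qed auto

text \<open>If all generators fixed the class of x, then so would the whole group, in particular x g
  inv x, whose displacement at x has the sign of g. The lemma supplies the letter that moves the
  largest element of F, and later reduces non-triviality to finitely many values.\<close>

lemma ex_moving_generator:
  assumes S: "S \<subseteq> carrier \<Gamma>" "generate \<Gamma> S = carrier \<Gamma>" and x: "x \<in> carrier \<Gamma>"
    and g: "g \<in> carrier \<Gamma>" "\<phi> g \<noteq> 0"
  shows "\<exists>s\<in>S. \<phi> (inv x \<otimes> s \<otimes> x) \<noteq> 0"
proof (rule ccontr)
  assume "\<not> ?thesis"
  then have "generate \<Gamma> S \<subseteq> {g \<in> carrier \<Gamma>. \<phi> (inv x \<otimes> g \<otimes> x) = 0}"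
    using S by (intro generate_subgroup_incl conjugate_core_subgroup x) auto
  moreover have "x \<otimes> g \<otimes> inv x \<in> generate \<Gamma> S"
    using x g S by simp
  ultimately have "\<phi> (inv x \<otimes> (x \<otimes> g \<otimes> inv x) \<otimes> x) = 0" by blast
  moreover have "inv x \<otimes> (x \<otimes> g \<otimes> inv x) \<otimes> x = g"
    using x g by (simp add: m_assoc cancel_inv)
  ultimately show False using g by simp
qed

end

text \<open>The order of the rationals is pulled back along the orbit map of q. It is left-invariant
  because \<rho> acts by order automorphisms, and its core is the stabilizer of q.\<close>

lemma orbit_sign_fun:
  assumes K: "group K" and \<rho>: "\<rho> \<in> hom K order_aut"
  shows "sign_fun K (\<lambda>g. if q < \<rho> g q then 1 else if \<rho> g q < q then -1 else 0)"
proof -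
  interpret group_hom K order_aut \<rho>
    using K \<rho> group_order_aut by (simp add: group_hom_def group_hom_axioms_def)
  have mono: "\<rho> g r < \<rho> g s \<longleftrightarrow> r < s" if "g \<in> carrier K" for g r s
    using hom_closed[OF that] strict_mono_less by auto
  have "\<rho> g (\<rho> h q) = q" if "g \<in> carrier K" "h \<in> carrier K" "g \<otimes>\<^bsub>K\<^esub> h = \<one>\<^bsub>K\<^esub>" for g h
  proof -
    have "\<rho> g \<circ> \<rho> h = id" using that hom_mult[of g h] hom_one by simp
    then show ?thesis by (simp add: fun_eq_iff)
  qed
  moreover have "q \<le> \<rho> (g \<otimes>\<^bsub>K\<^esub> h) q"
    if "g \<in> carrier K" "h \<in> carrier K" "q \<le> \<rho> g q" "q \<le> \<rho> h q" for g h
    using that hom_mult[of g h] mono[OF that(1), of "\<rho> h q" q] by auto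
  moreover have "(q < \<rho> h q \<longleftrightarrow> \<rho> g q < q) \<and> (\<rho> h q < q \<longleftrightarrow> q < \<rho> g q)"
    if "g \<in> carrier K" "h \<in> carrier K" "g \<otimes>\<^bsub>K\<^esub> h = \<one>\<^bsub>K\<^esub>" for g h
    using calculation(1)[OF that] mono[OF that(1), of q "\<rho> h q"] mono[OF that(1), of "\<rho> h q" q] by simp
  ultimately show ?thesis
    by (auto simp: sign_fun_def not_less split: if_splits)
qed

subsection \<open>Perturbing a sign function\<close>

text \<open>An internal free product, with the universal property stated for the target
  \<open>order_aut\<close>. The symmetry in A and B lets either factor supply the letter k.\<close>

locale free_pair = group \<Gamma> for \<Gamma> (structure) and A B +
  assumes subgroup_A: "subgroup A \<Gamma>" and subgroup_B: "subgroup B \<Gamma>"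
    and generators: "generate \<Gamma> (A \<union> B) = carrier \<Gamma>"
    and extension: "f \<in> hom (\<Gamma>\<lparr>carrier := A\<rparr>) order_aut \<Longrightarrow> g \<in> hom (\<Gamma>\<lparr>carrier := B\<rparr>) order_aut \<Longrightarrow>
      \<exists>h\<in>hom \<Gamma> order_aut. (\<forall>a\<in>A. h a = f a) \<and> (\<forall>b\<in>B. h b = g b)"
begin

lemma A_subset: "A \<subseteq> carrier \<Gamma>" and B_subset: "B \<subseteq> carrier \<Gamma>"
  using subgroup_A subgroup_B subgroup.subset by blast+

lemma swap: "free_pair \<Gamma> B A"
proof (intro free_pair.intro free_pair_axioms.intro)
  fix f g
  assume "f \<in> hom (\<Gamma>\<lparr>carrier := B\<rparr>) order_aut" "g \<in> hom (\<Gamma>\<lparr>carrier := A\<rparr>) order_aut"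
  then show "\<exists>h\<in>hom \<Gamma> order_aut. (\<forall>a\<in>B. h a = f a) \<and> (\<forall>b\<in>A. h b = g b)"
    using extension[of g f] by blast
next
  show "generate \<Gamma> (B \<union> A) = carrier \<Gamma>" using generators by (simp only: Un_commute)
qed (rule subgroup_A subgroup_B is_group)+

lemma A_realization:
  assumes "countable (carrier \<Gamma>)" "sign_fun \<Gamma> \<phi>"
  obtains \<alpha> pos where "\<alpha> \<in> hom (\<Gamma>\<lparr>carrier := A\<rparr>) order_aut"
    and "\<And>x y. x \<in> carrier \<Gamma> \<Longrightarrow> y \<in> carrier \<Gamma> \<Longrightarrow> pos x \<le> pos y \<longleftrightarrow> signed_group.below \<Gamma> \<phi> x y"
    and "\<And>a x. a \<in> A \<Longrightarrow> x \<in> carrier \<Gamma> \<Longrightarrow> \<alpha> a (pos x) = pos (a \<otimes> x)"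
proof -
  interpret \<phi>: signed_group \<Gamma> \<phi> by unfold_locales fact
  interpret P: total_preorder "carrier \<Gamma>" \<phi>.below by (rule \<phi>.below_total_preorder)
  interpret A: group "\<Gamma>\<lparr>carrier := A\<rparr>" by (rule subgroup_imp_group[OF subgroup_A])
  interpret preorder_action "carrier \<Gamma>" \<phi>.below "\<Gamma>\<lparr>carrier := A\<rparr>" "(\<otimes>)"
    using A_subset by unfold_locales (auto simp: m_assoc \<phi>.below_mult subset_iff)
  have "carrier \<Gamma> \<noteq> {}" by blast
  then show ?thesis using rational_realization[OF assms(1)] that by auto
qed

text \<open>B acts by left multiplication on the disjoint union of the group, ordered by \<phi>, and
  a copy of B, ordered by \<sigma> and lying above all of it. The first part preserves what is known
  on F; in the second, b moves the point \<open>Inr \<one>\<close> in the direction given by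
  \<sigma> b.\<close>

lemma B_realization:
  assumes "countable (carrier \<Gamma>)" "sign_fun \<Gamma> \<phi>" "sign_fun \<Gamma> \<sigma>"
  obtains \<beta> pos where "\<beta> \<in> hom (\<Gamma>\<lparr>carrier := B\<rparr>) order_aut"
    and "\<And>x y. x \<in> carrier \<Gamma> \<Longrightarrow> y \<in> carrier \<Gamma> \<Longrightarrow>
           pos (Inl x) \<le> pos (Inl y) \<longleftrightarrow> signed_group.below \<Gamma> \<phi> x y"
    and "\<And>b c. b \<in> B \<Longrightarrow> c \<in> B \<Longrightarrow> pos (Inr b) \<le> pos (Inr c) \<longleftrightarrow> signed_group.below \<Gamma> \<sigma> b c"
    and "\<And>x b. x \<in> carrier \<Gamma> \<Longrightarrow> b \<in> B \<Longrightarrow> pos (Inl x) < pos (Inr b)"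
    and "\<And>b x. b \<in> B \<Longrightarrow> x \<in> carrier \<Gamma> \<Longrightarrow> \<beta> b (pos (Inl x)) = pos (Inl (b \<otimes> x))"
    and "\<And>b c. b \<in> B \<Longrightarrow> c \<in> B \<Longrightarrow> \<beta> b (pos (Inr c)) = pos (Inr (b \<otimes> c))"
proof -
  interpret \<phi>: signed_group \<Gamma> \<phi> by unfold_locales fact
  interpret \<sigma>: signed_group \<Gamma> \<sigma> by unfold_locales fact
  interpret P: total_preorder "carrier \<Gamma>" \<phi>.below by (rule \<phi>.below_total_preorder)
  interpret Q: total_preorder "carrier \<Gamma>" \<sigma>.below by (rule \<sigma>.below_total_preorder)
  interpret B: group "\<Gamma>\<lparr>carrier := B\<rparr>" by (rule subgroup_imp_group[OF subgroup_B])
  let ?X = "carrier \<Gamma> <+> B"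
  define prec where "prec u v = (case u of
      Inl x \<Rightarrow> (case v of Inl y \<Rightarrow> \<phi>.below x y | Inr c \<Rightarrow> True)
    | Inr b \<Rightarrow> (case v of Inl y \<Rightarrow> False | Inr c \<Rightarrow> \<sigma>.below b c))" for u v
  have prec [simp]: "prec (Inl x) (Inl y) = \<phi>.below x y" "prec (Inl x) (Inr c)"
    "\<not> prec (Inr b) (Inl y)" "prec (Inr b) (Inr c) = \<sigma>.below b c" for x y b c
    by (auto simp: prec_def)
  have mult_B: "b \<in> B \<Longrightarrow> c \<in> B \<Longrightarrow> b \<otimes> c \<in> B" for b c
    using B.m_closed by simp
  interpret preorder_action ?X prec "\<Gamma>\<lparr>carrier := B\<rparr>" "\<lambda>b. map_sum ((\<otimes>) b) ((\<otimes>) b)"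
  proof unfold_locales
    fix u v assume "u \<in> ?X" "v \<in> ?X"
    then show "prec u v \<or> prec v u"
      using P.total[of "projl u" "projl v"] Q.total[of "projr u" "projr v"] B_subset
      by (cases u; cases v) auto
  next
    fix u v w assume "u \<in> ?X" "v \<in> ?X" "w \<in> ?X" "prec u v" "prec v w"
    then show "prec u w"
      using P.trans[of "projl u" "projl v" "projl w"] Q.trans[of "projr u" "projr v" "projr w"] B_subset
      by (cases u; cases v; cases w) auto
  next
    fix b u assume "b \<in> carrier (\<Gamma>\<lparr>carrier := B\<rparr>)" "u \<in> ?X"
    then show "map_sum ((\<otimes>) b) ((\<otimes>) b) u \<in> ?X"
      using B_subset by (auto simp: mult_B subset_iff)
  next
    fix u assume "u \<in> ?X"
    then show "map_sum ((\<otimes>) \<one>\<^bsub>\<Gamma>\<lparr>carrier := B\<rparr>\<^esub>) ((\<otimes>) \<one>\<^bsub>\<Gamma>\<lparr>carrier := B\<rparr>\<^esub>) u = u"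
      using B_subset by (auto simp: subset_iff)
  next
    fix b c u
    assume "b \<in> carrier (\<Gamma>\<lparr>carrier := B\<rparr>)" "c \<in> carrier (\<Gamma>\<lparr>carrier := B\<rparr>)" "u \<in> ?X"
    then show "map_sum ((\<otimes>) (b \<otimes>\<^bsub>\<Gamma>\<lparr>carrier := B\<rparr>\<^esub> c)) ((\<otimes>) (b \<otimes>\<^bsub>\<Gamma>\<lparr>carrier := B\<rparr>\<^esub> c)) u =
        map_sum ((\<otimes>) b) ((\<otimes>) b) (map_sum ((\<otimes>) c) ((\<otimes>) c) u)"
      using B_subset by (auto simp: subset_iff m_assoc)
  next
    fix b u v
    assume "b \<in> carrier (\<Gamma>\<lparr>carrier := B\<rparr>)" "u \<in> ?X" "v \<in> ?X" "prec u v"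
    then show "prec (map_sum ((\<otimes>) b) ((\<otimes>) b) u) (map_sum ((\<otimes>) b) ((\<otimes>) b) v)"
      using B_subset by (auto simp: subset_iff \<phi>.below_mult \<sigma>.below_mult)
  qed
  have X: "countable ?X" "?X \<noteq> {}"
    using assms(1) countable_subset[OF B_subset] by auto
  obtain \<beta> pos where \<beta>: "\<beta> \<in> hom (\<Gamma>\<lparr>carrier := B\<rparr>) order_aut"
    and pos: "\<And>u v. u \<in> ?X \<Longrightarrow> v \<in> ?X \<Longrightarrow> pos u \<le> pos v \<longleftrightarrow> prec u v"
    and \<beta>_pos: "\<And>b u. b \<in> carrier (\<Gamma>\<lparr>carrier := B\<rparr>) \<Longrightarrow> u \<in> ?X \<Longrightarrow>
        \<beta> b (pos u) = pos (map_sum ((\<otimes>) b) ((\<otimes>) b) u)"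
    by (rule rational_realization[OF X]) (rule that)
  have "pos (Inl x) < pos (Inr b)" if "x \<in> carrier \<Gamma>" "b \<in> B" for x b
    using that pos[of "Inr b" "Inl x"] by (auto simp: not_le[symmetric])
  then show ?thesis
    using \<beta> by (intro that[of \<beta> pos]) (simp_all add: pos \<beta>_pos InlI InrI)
qed

text \<open>
  The finite set \<open>F\<close> and the point \<open>k \<otimes> m\<close> above it keep their positions in the
  realization of \<open>\<phi>\<close> on \<open>\<rat>\<close>; the \<open>A\<close>-action is kept, and the \<open>B\<close>-action is conjugated by an
  order automorphism that fixes \<open>F\<close> and makes \<open>B\<close> act at \<open>k \<otimes> m\<close> as prescribed by \<open>\<sigma>\<close>.
\<close>

lemma perturbation:
  fixes len :: "'a \<Rightarrow> nat"
  assumes cnt: "countable (carrier \<Gamma>)" and \<phi>: "sign_fun \<Gamma> \<phi>" and \<sigma>: "sign_fun \<Gamma> \<sigma>"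
    and F: "finite F" "F \<subseteq> carrier \<Gamma>" "\<one> \<in> F"
    and chain: "\<And>x. x \<in> F \<Longrightarrow> x \<noteq> \<one> \<Longrightarrow> \<exists>s\<in>A \<union> B. \<exists>y\<in>F. x = s \<otimes> y \<and> len y < len x"
    and m: "m \<in> F" and k: "k \<in> A" and b: "b \<in> B"
    and top: "\<And>x. x \<in> F \<Longrightarrow> \<phi> (inv x \<otimes> (k \<otimes> m)) = 1"
  shows "\<exists>\<psi>. sign_fun \<Gamma> \<psi> \<and> (\<forall>x\<in>F. \<psi> x = \<phi> x) \<and> \<psi> (inv (k \<otimes> m) \<otimes> b \<otimes> (k \<otimes> m)) = \<sigma> b"
proof -
  interpret \<phi>: signed_group \<Gamma> \<phi> by unfold_locales fact
  interpret \<sigma>: signed_group \<Gamma> \<sigma> by unfold_locales fact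
  interpret O: group order_aut by (rule group_order_aut)
  define p where "p = k \<otimes> m"
  have p: "p \<in> carrier \<Gamma>" using k m F A_subset by (auto simp: p_def)
  have one_B: "\<one> \<in> B" using subgroup.one_closed[OF subgroup_B] .
  obtain \<alpha> posA where \<alpha>: "\<alpha> \<in> hom (\<Gamma>\<lparr>carrier := A\<rparr>) order_aut"
    and posA: "\<And>x y. x \<in> carrier \<Gamma> \<Longrightarrow> y \<in> carrier \<Gamma> \<Longrightarrow> posA x \<le> posA y \<longleftrightarrow> \<phi>.below x y"
    and \<alpha>_pos: "\<And>a x. a \<in> A \<Longrightarrow> x \<in> carrier \<Gamma> \<Longrightarrow> \<alpha> a (posA x) = posA (a \<otimes> x)"
    by (rule A_realization[OF cnt \<phi>]) (rule that)
  obtain \<beta> posB where \<beta>: "\<beta> \<in> hom (\<Gamma>\<lparr>carrier := B\<rparr>) order_aut"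
    and posB: "\<And>x y. x \<in> carrier \<Gamma> \<Longrightarrow> y \<in> carrier \<Gamma> \<Longrightarrow> posB (Inl x) \<le> posB (Inl y) \<longleftrightarrow> \<phi>.below x y"
      "\<And>b c. b \<in> B \<Longrightarrow> c \<in> B \<Longrightarrow> posB (Inr b) \<le> posB (Inr c) \<longleftrightarrow> \<sigma>.below b c"
      "\<And>x b. x \<in> carrier \<Gamma> \<Longrightarrow> b \<in> B \<Longrightarrow> posB (Inl x) < posB (Inr b)"
    and \<beta>_pos: "\<And>b x. b \<in> B \<Longrightarrow> x \<in> carrier \<Gamma> \<Longrightarrow> \<beta> b (posB (Inl x)) = posB (Inl (b \<otimes> x))"
      "\<And>b c. b \<in> B \<Longrightarrow> c \<in> B \<Longrightarrow> \<beta> b (posB (Inr c)) = posB (Inr (b \<otimes> c))"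
    by (rule B_realization[OF cnt \<phi> \<sigma>]) (rule that)
  \<comment> \<open>Among the points of the upper copy only \<open>Inr \<one>\<close> will be
    matched. The rest of its orbit goes wherever the extension of the finite map takes it.\<close>
  define target where "target u = (case u of Inl x \<Rightarrow> posA x | Inr _ \<Rightarrow> posA p)" for u :: "'a + 'a"
  have above: "posA x < posA p" if "x \<in> F" for x
  proof -
    have "\<not> \<phi>.below p x"
      using top[OF that] that F(2) p \<phi>.sign_swap[of x p] by (auto simp: \<phi>.below_def p_def)
    then show ?thesis using posA[of p x] p that F(2) by auto
  qed
  have "\<exists>\<tau>\<in>carrier order_aut. \<forall>u\<in>Inl ` F \<union> {Inr \<one>}. \<tau> (posB u) = target u"
  proof (rule order_aut_extension)
    show "finite (Inl ` F \<union> {Inr \<one>})" using F by simp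
  next
    fix u v assume "u \<in> Inl ` F \<union> {Inr \<one>}" "v \<in> Inl ` F \<union> {Inr \<one>}"
    then consider (ll) x y where "u = Inl x" "v = Inl y" "x \<in> F" "y \<in> F"
      | (lr) x where "u = Inl x" "v = Inr \<one>" "x \<in> F"
      | (rl) x where "u = Inr \<one>" "v = Inl x" "x \<in> F"
      | (rr) "u = Inr \<one>" "v = Inr \<one>" by blast
    then show "posB u \<le> posB v \<longleftrightarrow> target u \<le> target v"
    proof cases
      case ll
      then show ?thesis using posA posB(1) F(2) by (auto simp: target_def subset_iff)
    next
      case lr
      then show ?thesis using above posB(3)[of x \<one>] F(2) one_B by (auto simp: target_def less_imp_le)
    next
      case rl
      then show ?thesis using above[of x] posB(3)[of x \<one>] F(2) one_B by (auto simp: target_def)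
    qed auto
  qed
  then obtain \<tau> where \<tau>: "\<tau> \<in> carrier order_aut" "\<And>x. x \<in> F \<Longrightarrow> \<tau> (posB (Inl x)) = posA x"
    "\<tau> (posB (Inr \<one>)) = posA p"
    by (auto simp: target_def)
  define \<tau>' where "\<tau>' = inv\<^bsub>order_aut\<^esub> \<tau>"
  have \<tau>': "\<tau>' \<in> carrier order_aut" "\<And>q. \<tau>' (\<tau> q) = q" "\<And>q. \<tau> (\<tau>' q) = q"
    using O.inv_closed[OF \<tau>(1)] O.l_inv[OF \<tau>(1)] O.r_inv[OF \<tau>(1)]
    by (auto simp: \<tau>'_def fun_eq_iff)
  \<comment> \<open>Conjugation moves the B-action to the positions used by the A-action, so that
    both act on the same copy of F.\<close>
  define \<gamma> where "\<gamma> c = \<tau> \<circ> \<beta> c \<circ> \<tau>'" for c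
  have "\<gamma> \<in> hom (\<Gamma>\<lparr>carrier := B\<rparr>) order_aut"
  proof (rule homI)
    fix c assume "c \<in> carrier (\<Gamma>\<lparr>carrier := B\<rparr>)"
    then show "\<gamma> c \<in> carrier order_aut"
      using O.m_closed[OF O.m_closed[OF \<tau>(1) hom_in_carrier[OF \<beta>]] \<tau>'(1)] by (simp add: \<gamma>_def)
  next
    fix c d assume "c \<in> carrier (\<Gamma>\<lparr>carrier := B\<rparr>)" "d \<in> carrier (\<Gamma>\<lparr>carrier := B\<rparr>)"
    then show "\<gamma> (c \<otimes>\<^bsub>\<Gamma>\<lparr>carrier := B\<rparr>\<^esub> d) = \<gamma> c \<otimes>\<^bsub>order_aut\<^esub> \<gamma> d"
      using hom_mult[OF \<beta>] \<tau>'(2) by (simp add: \<gamma>_def fun_eq_iff)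
  qed
  then obtain \<rho> where \<rho>: "\<rho> \<in> hom \<Gamma> order_aut" "\<And>a. a \<in> A \<Longrightarrow> \<rho> a = \<alpha> a" "\<And>c. c \<in> B \<Longrightarrow> \<rho> c = \<gamma> c"
    using extension[OF \<alpha>] by blast
  interpret \<rho>: group_hom \<Gamma> order_aut \<rho> by unfold_locales (rule \<rho>(1))
  have \<rho>_mult: "\<rho> (g \<otimes> h) q = \<rho> g (\<rho> h q)" if "g \<in> carrier \<Gamma>" "h \<in> carrier \<Gamma>" for g h q
    using \<rho>.hom_mult[OF that] by simp
  have \<rho>_less: "\<rho> g q < \<rho> g r \<longleftrightarrow> q < r" if "g \<in> carrier \<Gamma>" for g q r
    using \<rho>.hom_closed[OF that] strict_mono_less by auto
  \<comment> \<open>Induction along suffixes. The first letter s takes the position of y to that of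
    x in either case: for s in A the action is unchanged, and for s in B both x and y lie in F,
    where \<tau> matches the two realizations.\<close>
  have reach: "\<rho> x (posA \<one>) = posA x" if "x \<in> F" for x
    using that
  proof (induction "len x" arbitrary: x rule: less_induct)
    case less
    show ?case
    proof (cases "x = \<one>")
      case True
      then show ?thesis using \<rho>.hom_one by simp
    next
      case False
      then obtain s y where s: "s \<in> A \<union> B" "y \<in> F" "x = s \<otimes> y" "len y < len x"
        using chain less.prems by blast
      have y: "y \<in> carrier \<Gamma>" "s \<in> carrier \<Gamma>" using s F(2) A_subset B_subset by auto
      have "\<rho> s (posA y) = posA x"
      proof (cases "s \<in> A")
        case True
        then show ?thesis using \<rho>(2) \<alpha>_pos s y by simp
      next
        case False
        then have "s \<in> B" using s by simp
        then have "\<rho> s (posA y) = \<tau> (posB (Inl x))"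
          using \<rho>(3) \<beta>_pos(1) s(3) y \<tau>(2)[OF s(2)] \<tau>'(2)[of "posB (Inl y)"] by (simp add: \<gamma>_def)
        then show ?thesis using \<tau>(2) less.prems by simp
      qed
      then show ?thesis using less.hyps s y \<rho>_mult by simp
    qed
  qed
  \<comment> \<open>With the position of the identity as base point, \<open>reach\<close> makes
    \<psi> x compare \<open>posA x\<close> with \<open>posA \<one>\<close>, which is \<phi>
    x.\<close>
  define \<psi> :: "'a \<Rightarrow> int" where
    "\<psi> g = (if posA \<one> < \<rho> g (posA \<one>) then 1 else if \<rho> g (posA \<one>) < posA \<one> then -1 else 0)" for g
  have "sign_fun \<Gamma> \<psi>"
    unfolding \<psi>_def by (rule orbit_sign_fun[OF _ \<rho>(1)]) unfold_locales
  moreover have "\<psi> x = \<phi> x" if "x \<in> F" for x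
  proof -
    have x: "x \<in> carrier \<Gamma>" using that F(2) by blast
    then show ?thesis
      using \<phi>.sign_eq_below[of \<one> x] posA[of \<one> x] posA[of x \<one>] reach[OF that]
      by (auto simp: \<psi>_def not_le[symmetric])
  qed
  moreover have "\<psi> (inv p \<otimes> b \<otimes> p) = \<sigma> b"
  proof -
    have bc: "b \<in> carrier \<Gamma>" "k \<in> carrier \<Gamma>" "m \<in> carrier \<Gamma>"
      using b k m F(2) A_subset B_subset by auto
    \<comment> \<open>p lies outside F, but is one A-letter away from m in F, and the A-action was
      not modified.\<close>
    have \<rho>p: "\<rho> p (posA \<one>) = posA p"
      using bc k m reach \<rho>(2) \<alpha>_pos by (simp add: p_def \<rho>_mult)
    have \<rho>b: "\<rho> b (posA p) = \<tau> (posB (Inr b))"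
      using \<rho>(3)[OF b] \<beta>_pos(2)[OF b one_B] \<tau>(3) \<tau>'(2)[of "posB (Inr \<one>)"] bc by (simp add: \<gamma>_def)
    let ?t = "inv p \<otimes> b \<otimes> p"
    \<comment> \<open>As \<rho> p preserves the order, ?t displaces the base point in the same
      direction as b displaces the position of p.\<close>
    have "p \<otimes> ?t = b \<otimes> p"
      using p bc by (simp add: m_assoc cancel_inv)
    then have "\<rho> p (\<rho> ?t (posA \<one>)) = \<rho> b (\<rho> p (posA \<one>))"
      using \<rho>_mult[of p ?t "posA \<one>"] \<rho>_mult[of b p "posA \<one>"] p bc by (metis inv_closed m_closed)
    then have \<rho>t: "\<rho> p (\<rho> ?t (posA \<one>)) = \<tau> (posB (Inr b))"
      by (simp only: \<rho>p \<rho>b)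
    have \<tau>_less: "\<tau> q < \<tau> r \<longleftrightarrow> q < r" for q r
      using \<tau>(1) strict_mono_less by auto
    have "posA \<one> < \<rho> ?t (posA \<one>) \<longleftrightarrow> posB (Inr \<one>) < posB (Inr b)"
      using \<rho>_less[OF p, of "posA \<one>" "\<rho> ?t (posA \<one>)"] \<rho>p \<rho>t \<tau>(3) \<tau>_less by metis
    moreover have "\<rho> ?t (posA \<one>) < posA \<one> \<longleftrightarrow> posB (Inr b) < posB (Inr \<one>)"
      using \<rho>_less[OF p, of "\<rho> ?t (posA \<one>)" "posA \<one>"] \<rho>p \<rho>t \<tau>(3) \<tau>_less by metis
    ultimately show ?thesis
      using \<sigma>.sign_eq_below[of \<one> b] posB(2)[OF one_B b] posB(2)[OF b one_B] bc
      by (auto simp: \<psi>_def not_le[symmetric])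
  qed
  ultimately show ?thesis unfolding p_def by blast
qed

text \<open>The opposite of the behaviour of \<phi> at p is available in both cases. If some b moves
  p, the zero function prescribes that it be fixed; if all of B fixes p, a non-trivial b is made to
  move by the left-order.\<close>

lemma flexible_element_aux:
  assumes \<phi>: "sign_fun \<Gamma> \<phi>" and \<sigma>: "sign_fun \<Gamma> \<sigma>" "\<And>b. b \<in> B \<Longrightarrow> b \<noteq> \<one> \<Longrightarrow> \<sigma> b \<noteq> 0"
    and B: "B \<noteq> {\<one>}"
  shows "\<exists>b\<in>B. \<exists>\<sigma>. sign_fun \<Gamma> \<sigma> \<and> \<phi> (inv p \<otimes> b \<otimes> p) \<noteq> \<sigma> b"
proof (cases "\<exists>b\<in>B. \<phi> (inv p \<otimes> b \<otimes> p) \<noteq> 0")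
  case True
  then show ?thesis using sign_fun_zero by (metis (full_types))
next
  case False
  obtain b where "b \<in> B" "b \<noteq> \<one>"
    using B subgroup.one_closed[OF subgroup_B] by blast
  then show ?thesis using False \<sigma> by metis
qed

text \<open>The factor of k is dictated by \<phi>, so the conclusion leaves open which of A and B
  contains k, and left-orders on both are required.\<close>

lemma flexible_element:
  assumes \<phi>: "sign_fun \<Gamma> \<phi>" "g \<in> carrier \<Gamma>" "\<phi> g \<noteq> 0"
    and F: "finite F" "F \<noteq> {}" "F \<subseteq> carrier \<Gamma>"
    and \<sigma>A: "sign_fun \<Gamma> \<sigma>A" "\<And>a. a \<in> A \<Longrightarrow> a \<noteq> \<one> \<Longrightarrow> \<sigma>A a \<noteq> 0" "A \<noteq> {\<one>}"
    and \<sigma>B: "sign_fun \<Gamma> \<sigma>B" "\<And>b. b \<in> B \<Longrightarrow> b \<noteq> \<one> \<Longrightarrow> \<sigma>B b \<noteq> 0" "B \<noteq> {\<one>}"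
  shows "\<exists>m\<in>F. \<exists>k b \<sigma>. (k \<in> A \<and> b \<in> B \<or> k \<in> B \<and> b \<in> A) \<and> sign_fun \<Gamma> \<sigma> \<and>
           (\<forall>x\<in>F. \<phi> (inv x \<otimes> (k \<otimes> m)) = 1) \<and> \<phi> (inv (k \<otimes> m) \<otimes> b \<otimes> (k \<otimes> m)) \<noteq> \<sigma> b"
proof -
  interpret \<phi>: signed_group \<Gamma> \<phi> by unfold_locales fact
  interpret P: total_preorder "carrier \<Gamma>" \<phi>.below by (rule \<phi>.below_total_preorder)
  interpret swap: free_pair \<Gamma> B A by (rule swap)
  obtain m where m: "m \<in> F" "\<And>x. x \<in> F \<Longrightarrow> \<phi>.below x m"
    using P.ex_greatest[OF F] by blast
  have mc: "m \<in> carrier \<Gamma>" using m F by blast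
  obtain s where s: "s \<in> A \<union> B" "\<phi> (inv m \<otimes> s \<otimes> m) \<noteq> 0"
    using \<phi>.ex_moving_generator[OF Un_least[OF A_subset B_subset] generators mc \<phi>(2,3)] by blast
  have sc: "s \<in> carrier \<Gamma>" using s A_subset B_subset by blast
  \<comment> \<open>A letter that moves m downwards is replaced by its inverse, which moves m
    upwards and lies in the same factor.\<close>
  define k where "k = (if \<phi> (inv m \<otimes> s \<otimes> m) = 1 then s else inv s)"
  have k: "k \<in> A \<and> s \<in> A \<or> k \<in> B \<and> s \<in> B"
    using s(1) subgroup_A subgroup_B by (auto simp: k_def subgroup.m_inv_closed)
  have kc: "k \<in> carrier \<Gamma>" using sc by (simp add: k_def)
  have "\<phi> (inv m \<otimes> k \<otimes> m) = 1"
  proof (cases "\<phi> (inv m \<otimes> s \<otimes> m) = 1")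
    case False
    then have "\<phi> (inv (inv m \<otimes> s \<otimes> m)) = 1"
      using s(2) \<phi>.sign_range[of "inv m \<otimes> s \<otimes> m"] \<phi>.sign_inv[of "inv m \<otimes> s \<otimes> m"] mc sc by auto
    then show ?thesis using False mc sc by (simp add: k_def inv_mult_group m_assoc)
  qed (simp add: k_def)
  then have "\<not> \<phi>.below (k \<otimes> m) m"
    using \<phi>.sign_swap[of m "k \<otimes> m"] mc kc by (simp add: \<phi>.below_def m_assoc)
  then have "\<not> \<phi>.below (k \<otimes> m) x" if "x \<in> F" for x
    using P.trans[of "k \<otimes> m" x m] m(2)[OF that] that F(3) mc kc by blast
  then have top: "\<phi> (inv x \<otimes> (k \<otimes> m)) = 1" if "x \<in> F" for x
    using \<phi>.sign_eq_below[of x "k \<otimes> m"] that F(3) mc kc by auto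
  have "\<exists>b \<sigma>. (k \<in> A \<and> b \<in> B \<or> k \<in> B \<and> b \<in> A) \<and> sign_fun \<Gamma> \<sigma> \<and>
      \<phi> (inv (k \<otimes> m) \<otimes> b \<otimes> (k \<otimes> m)) \<noteq> \<sigma> b"
    using k flexible_element_aux[OF \<phi>(1) \<sigma>B, of "k \<otimes> m"]
      swap.flexible_element_aux[OF \<phi>(1) \<sigma>A, of "k \<otimes> m"] by blast
  then show ?thesis using top m(1) by blast
qed

end

subsection \<open>Preorders as sign functions\<close>

context group
begin

lemma left_preorder_iff_one:
  assumes r: "left_invariant G r" "x \<in> carrier G" "y \<in> carrier G"
  shows "(x, y) \<in> r \<longleftrightarrow> (\<one>, inv x \<otimes> y) \<in> r"
proof
  assume "(x, y) \<in> r"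
  then have "(inv x \<otimes> x, inv x \<otimes> y) \<in> r"
    using r unfolding left_invariant_def by (meson inv_closed)
  then show "(\<one>, inv x \<otimes> y) \<in> r" using r by simp
next
  assume "(\<one>, inv x \<otimes> y) \<in> r"
  then have "(x \<otimes> \<one>, x \<otimes> (inv x \<otimes> y)) \<in> r"
    using r unfolding left_invariant_def by (meson inv_closed m_closed one_closed)
  then show "(x, y) \<in> r" using r by (simp add: cancel_inv)
qed

text \<open>The inverse of the positive cone consists of the elements strictly below the identity.
  The last 0 is the default for an element incomparable with the identity, a case that totality
  excludes later.\<close>

lemma preorder_map_eq:
  assumes r: "left_invariant G r" "refl_on (carrier G) r" and g: "g \<in> carrier G"
  shows "preorder_map G r g =
           (if (\<one>, g) \<in> r then if (g, \<one>) \<in> r then 0 else 1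
            else if (g, \<one>) \<in> r then -1 else 0)"
proof -
  have pos: "h \<in> positive_cone G r \<longleftrightarrow> h \<in> carrier G \<and> (\<one>, h) \<in> r \<and> (h, \<one>) \<notin> r" for h
    by (auto simp: positive_cone_def preorder_core_def)
  have inv_iff: "(\<one>, inv h) \<in> r \<longleftrightarrow> (h, \<one>) \<in> r" if "h \<in> carrier G" for h
    using left_preorder_iff_one[OF r(1) that one_closed] that by simp
  have "g \<in> set_inv (positive_cone G r) \<longleftrightarrow> inv g \<in> positive_cone G r"
  proof
    assume "g \<in> set_inv (positive_cone G r)"
    then show "inv g \<in> positive_cone G r" by (auto simp: SET_INV_def pos)
  next
    assume "inv g \<in> positive_cone G r"
    then show "g \<in> set_inv (positive_cone G r)"
      using g by (auto simp: SET_INV_def intro!: bexI[of _ "inv g"])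
  qed
  also have "\<dots> \<longleftrightarrow> (g, \<one>) \<in> r \<and> (\<one>, g) \<notin> r"
    using g inv_iff[of g] inv_iff[of "inv g"] by (auto simp: pos)
  finally show ?thesis
    using g by (auto simp: preorder_map_def pos)
qed

lemma preorder_map_sign_fun:
  assumes "left_preorder G r"
  shows "sign_fun G (preorder_map G r)" "\<exists>g\<in>carrier G. preorder_map G r g \<noteq> 0"
proof -
  have r: "left_invariant G r" "refl_on (carrier G) r" "trans r" "r \<subseteq> carrier G \<times> carrier G"
      "total_on (carrier G) r" "r \<noteq> carrier G \<times> carrier G"
    using assms by (auto simp: left_preorder_def preorder_on_def)
  note eq = preorder_map_eq[OF r(1,2)]
  have total: "(x, y) \<in> r \<or> (y, x) \<in> r" if "x \<in> carrier G" "y \<in> carrier G" for x y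
    using r(2,5) that by (cases "x = y") (auto simp: total_on_def refl_on_def)
  have inv_iff: "(\<one>, h) \<in> r \<longleftrightarrow> (g, \<one>) \<in> r" "(h, \<one>) \<in> r \<longleftrightarrow> (\<one>, g) \<in> r"
    if "g \<in> carrier G" "h \<in> carrier G" "g \<otimes> h = \<one>" for g h
  proof -
    have "inv h = g" using that by (intro inv_equality)
    then have "inv g = h" using that by auto
    note this \<open>inv h = g\<close>
    then show "(\<one>, h) \<in> r \<longleftrightarrow> (g, \<one>) \<in> r" "(h, \<one>) \<in> r \<longleftrightarrow> (\<one>, g) \<in> r"
      using left_preorder_iff_one[OF r(1) that(1) one_closed]
        left_preorder_iff_one[OF r(1) that(2) one_closed] that by auto
  qed
  have nonneg: "0 \<le> preorder_map G r g \<longleftrightarrow> (\<one>, g) \<in> r" if "g \<in> carrier G" for g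
    using total[OF that one_closed] eq[OF that] by auto
  have mult: "(\<one>, g \<otimes> h) \<in> r" if "g \<in> carrier G" "h \<in> carrier G" "(\<one>, g) \<in> r" "(\<one>, h) \<in> r" for g h
  proof -
    have "(g, g \<otimes> h) \<in> r"
      using left_preorder_iff_one[OF r(1), of g "g \<otimes> h"] that by (simp add: cancel_inv)
    then show ?thesis using that r(3) by (meson transD)
  qed
  show "sign_fun G (preorder_map G r)"
    unfolding sign_fun_def
  proof (intro conjI ballI impI)
    fix g assume g: "g \<in> carrier G"
    then show "preorder_map G r g \<in> {-1, 0, 1}" by (simp add: eq)
    fix h assume h: "h \<in> carrier G"
    show "preorder_map G r h = - preorder_map G r g" if "g \<otimes> h = \<one>"
      using inv_iff[OF g h that] g h by (simp add: eq)
    show "0 \<le> preorder_map G r (g \<otimes> h)" if "0 \<le> preorder_map G r g" "0 \<le> preorder_map G r h"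
      using that nonneg mult g h by simp
  qed
  obtain x y where "x \<in> carrier G" "y \<in> carrier G" "(x, y) \<notin> r" using r by auto
  then show "\<exists>g\<in>carrier G. preorder_map G r g \<noteq> 0"
    using left_preorder_iff_one[OF r(1), of x y] nonneg[of "inv x \<otimes> y"]
    by (intro bexI[of _ "inv x \<otimes> y"]) auto
qed

lemma sign_fun_preorder:
  assumes \<phi>: "sign_fun G \<phi>" "g \<in> carrier G" "\<phi> g \<noteq> 0"
  defines "r \<equiv> {(x, y) \<in> carrier G \<times> carrier G. signed_group.below G \<phi> x y}"
  shows "left_preorder G r" "preorder_map G r = restrict \<phi> (carrier G)"
proof -
  interpret \<phi>: signed_group G \<phi> by unfold_locales fact
  interpret P: total_preorder "carrier G" \<phi>.below by (rule \<phi>.below_total_preorder)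
  have inv: "left_invariant G r"
    by (auto simp: left_invariant_def r_def \<phi>.below_mult)
  have refl: "refl_on (carrier G) r"
    using P.refl by (auto simp: refl_on_def r_def)
  have "trans r"
  proof (rule transI)
    fix x y z assume "(x, y) \<in> r" "(y, z) \<in> r"
    then show "(x, z) \<in> r" using P.trans[of x y z] by (simp add: r_def)
  qed
  moreover have "total_on (carrier G) r"
  proof (rule total_onI)
    fix x y assume "x \<in> carrier G" "y \<in> carrier G"
    then show "(x, y) \<in> r \<or> (y, x) \<in> r" using P.total[of x y] by (simp add: r_def)
  qed
  moreover have "r \<noteq> carrier G \<times> carrier G"
  proof -
    have "\<not> \<phi>.below \<one> g \<or> \<not> \<phi>.below g \<one>"
      using \<phi>.sign_inv[of g] \<phi> by (auto simp: \<phi>.below_def)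
    then show ?thesis using \<phi>(2) by (auto simp: r_def)
  qed
  moreover have "r \<subseteq> carrier G \<times> carrier G" by (auto simp: r_def)
  ultimately show "left_preorder G r"
    using inv refl by (simp add: left_preorder_def preorder_on_def)
  show "preorder_map G r = restrict \<phi> (carrier G)"
  proof
    fix h
    show "preorder_map G r h = restrict \<phi> (carrier G) h"
    proof (cases "h \<in> carrier G")
      case True
      then show ?thesis
        using preorder_map_eq[OF inv refl True] \<phi>.sign_eq_below[of \<one> h] P.total[of \<one> h]
        by (auto simp: r_def)
    qed (simp add: preorder_map_def)
  qed
qed

text \<open>This is the form in which the topology can be used: on extensional functions, everything
  except non-vanishing is a family of conditions on finitely many coordinates each.\<close>

lemma PO_iff:
  "\<phi> \<in> PO G \<longleftrightarrow> \<phi> \<in> extensional (carrier G) \<and> sign_fun G \<phi> \<and> (\<exists>g\<in>carrier G. \<phi> g \<noteq> 0)"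
proof
  assume "\<phi> \<in> PO G"
  then show "\<phi> \<in> extensional (carrier G) \<and> sign_fun G \<phi> \<and> (\<exists>g\<in>carrier G. \<phi> g \<noteq> 0)"
    using preorder_map_sign_fun by (auto simp: PO_def preorder_map_def)
next
  assume *: "\<phi> \<in> extensional (carrier G) \<and> sign_fun G \<phi> \<and> (\<exists>g\<in>carrier G. \<phi> g \<noteq> 0)"
  then obtain g where "g \<in> carrier G" "\<phi> g \<noteq> 0" by blast
  then show "\<phi> \<in> PO G"
    using * sign_fun_preorder[of \<phi> g] by (auto simp: PO_def extensional_restrict intro!: image_eqI)
qed

lemma left_orderable_sign_fun:
  assumes "left_orderable G"
  shows "\<exists>\<sigma>. sign_fun G \<sigma> \<and> (\<forall>g\<in>carrier G. g \<noteq> \<one> \<longrightarrow> \<sigma> g \<noteq> 0)"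
proof (cases "carrier G = {\<one>}")
  \<comment> \<open>On the trivial group the order is the full relation, which
    \<open>left_preorder\<close> excludes; the zero function meets the requirement
    vacuously.\<close>
  case True
  then show ?thesis using sign_fun_zero by blast
next
  case False
  obtain r where r: "linear_order_on (carrier G) r" "left_invariant G r"
    using assms by (auto simp: left_orderable_def)
  have refl: "refl_on (carrier G) r" and anti: "antisym r" and total: "total_on (carrier G) r"
    using r by (auto simp: order_on_defs)
  obtain g where g: "g \<in> carrier G" "g \<noteq> \<one>" using False one_closed by blast
  have "(\<one>, g) \<notin> r \<or> (g, \<one>) \<notin> r" using anti g by (auto simp: antisym_def)
  then have "r \<noteq> carrier G \<times> carrier G" using g by auto
  then have "left_preorder G r"
    using r by (auto simp: left_preorder_def order_on_defs)
  moreover have "preorder_map G r h \<noteq> 0" if "h \<in> carrier G" "h \<noteq> \<one>" for h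
    using preorder_map_eq[OF r(2) refl that(1)] anti total that
    by (auto simp: antisym_def total_on_def)
  ultimately show ?thesis using preorder_map_sign_fun(1) by blast
qed

lemma countable_generate:
  assumes "countable S"
  shows "countable (generate G S)"
proof -
  \<comment> \<open>Inverses enter at stage 0 only, because \<open>generate\<close> inverts only
    members of S; afterwards each stage adds the products of two earlier elements.\<close>
  define L where "L = rec_nat (S \<union> (\<lambda>x. inv x) ` S) (\<lambda>_ U. insert \<one> (U \<union> (\<lambda>(x, y). x \<otimes> y) ` (U \<times> U)))"
  have L [simp]: "L 0 = S \<union> (\<lambda>x. inv x) ` S"
      "L (Suc n) = insert \<one> (L n \<union> (\<lambda>(x, y). x \<otimes> y) ` (L n \<times> L n))" for n
    by (simp_all add: L_def)
  have mono: "L m \<subseteq> L n" if "m \<le> n" for m n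
    using lift_Suc_mono_le[of L, OF _ that] by auto
  have "g \<in> (\<Union>n. L n)" if "g \<in> generate G S" for g
    using that
  proof induction
    case one
    have "\<one> \<in> L (Suc 0)" by simp
    then show ?case by blast
  next
    case (incl h)
    then have "h \<in> L 0" by simp
    then show ?case by blast
  next
    case (inv h)
    then have "inv h \<in> L 0" by simp
    then show ?case by blast
  next
    case (eng g h)
    then obtain m n where "g \<in> L m" "h \<in> L n" by blast
    then have "g \<in> L (max m n)" "h \<in> L (max m n)"
      using mono[of m "max m n"] mono[of n "max m n"] by auto
    then have "g \<otimes> h \<in> (\<lambda>(x, y). x \<otimes> y) ` (L (max m n) \<times> L (max m n))"
      by (intro image_eqI[of _ _ "(g, h)"]) auto
    then have "g \<otimes> h \<in> L (Suc (max m n))" by simp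
    then show ?case by blast
  qed
  moreover have "countable (L n)" for n
    by (induction n) (use assms in auto)
  then have "countable (\<Union>n. L n)" by blast
  ultimately show ?thesis using countable_subset[of "generate G S" "\<Union>n. L n"] by blast
qed

end

subsection \<open>Free products\<close>

lemma sign_fun_comp:
  assumes "group_hom K L h" "sign_fun L \<sigma>"
  shows "sign_fun K (\<lambda>g. \<sigma> (h g))"
proof -
  interpret group_hom K L h by fact
  have "h x \<otimes>\<^bsub>L\<^esub> h y = \<one>\<^bsub>L\<^esub>" if "x \<in> carrier K" "y \<in> carrier K" "x \<otimes>\<^bsub>K\<^esub> y = \<one>\<^bsub>K\<^esub>" for x y
    using that hom_mult[of x y] hom_one by simp
  then show ?thesis
    using assms(2) hom_closed by (simp add: sign_fun_def)
qed

context group_pair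
begin

lemma fp_letter_mult:
  assumes "x # w \<in> reduced_words G H"
  shows "[x] \<otimes>\<^bsub>free_product G H\<^esub> w = x # w"
  using assms foldr_fp_cons_Nil[OF assms] foldr_fp_cons_Nil[of w]
  by (simp add: free_product_def reduced_words_Cons)

lemma fp_letter_mem:
  assumes "x \<in> fp_letters G H"
  shows "[x] \<in> fp_inl G ` carrier G \<union> fp_inr H ` carrier H"
  using assms by (cases x) (force simp: fp_inl_def fp_inr_def image_iff)+

lemma free_pair_free_product:
  "free_pair (free_product G H) (fp_inl G ` carrier G) (fp_inr H ` carrier H)"
proof -
  interpret \<Gamma>: group "free_product G H" by (rule group_free_product)
  interpret l: group_hom G "free_product G H" "fp_inl G" using fp_inl_hom by unfold_locales
  interpret r: group_hom H "free_product G H" "fp_inr H" using fp_inr_hom by unfold_locales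
  let ?A = "fp_inl G ` carrier G" and ?B = "fp_inr H ` carrier H"
  show ?thesis
  proof (intro free_pair.intro free_pair_axioms.intro)
    show "group (free_product G H)" by (rule group_free_product)
    show "subgroup ?A (free_product G H)" by (rule l.img_is_subgroup)
    show "subgroup ?B (free_product G H)" by (rule r.img_is_subgroup)
    have "w \<in> generate (free_product G H) (?A \<union> ?B)" if "w \<in> reduced_words G H" for w
      using that
    proof (induction w)
      case Nil
      then show ?case using generate.one[of "free_product G H"] by (simp add: free_product_def)
    next
      case (Cons x w)
      then have "[x] \<in> ?A \<union> ?B" "w \<in> generate (free_product G H) (?A \<union> ?B)"
        using fp_letter_mem by (auto simp: reduced_words_Cons)
      then show ?case
        using fp_letter_mult[OF Cons.prems] by (metis generate.eng generate.incl)
    qed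
    then show "generate (free_product G H) (?A \<union> ?B) = carrier (free_product G H)"
      using \<Gamma>.generate_incl[of "?A \<union> ?B"] l.hom_closed r.hom_closed
      by (intro equalityI) (auto simp: free_product_def)
  next
    fix f g
    assume f: "f \<in> hom (free_product G H\<lparr>carrier := ?A\<rparr>) order_aut"
      and g: "g \<in> hom (free_product G H\<lparr>carrier := ?B\<rparr>) order_aut"
    have "f \<circ> fp_inl G \<in> hom G order_aut"
    proof (rule homI)
      fix x assume "x \<in> carrier G"
      then show "(f \<circ> fp_inl G) x \<in> carrier order_aut" using hom_in_carrier[OF f] by simp
    next
      fix x y assume "x \<in> carrier G" "y \<in> carrier G"
      then show "(f \<circ> fp_inl G) (x \<otimes>\<^bsub>G\<^esub> y) = (f \<circ> fp_inl G) x \<otimes>\<^bsub>order_aut\<^esub> (f \<circ> fp_inl G) y"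
        using hom_mult[OF f, of "fp_inl G x" "fp_inl G y"] by simp
    qed
    moreover have "g \<circ> fp_inr H \<in> hom H order_aut"
    proof (rule homI)
      fix x assume "x \<in> carrier H"
      then show "(g \<circ> fp_inr H) x \<in> carrier order_aut" using hom_in_carrier[OF g] by simp
    next
      fix x y assume "x \<in> carrier H" "y \<in> carrier H"
      then show "(g \<circ> fp_inr H) (x \<otimes>\<^bsub>H\<^esub> y) = (g \<circ> fp_inr H) x \<otimes>\<^bsub>order_aut\<^esub> (g \<circ> fp_inr H) y"
        using hom_mult[OF g, of "fp_inr H x" "fp_inr H y"] by simp
    qed
    ultimately show "\<exists>h\<in>hom (free_product G H) order_aut. (\<forall>a\<in>?A. h a = f a) \<and> (\<forall>b\<in>?B. h b = g b)"
      using free_product_universal_existence[OF group_order_aut] by fastforce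
  qed
qed

text \<open>The left-order of G is pulled back along the retraction that kills H. The result
  vanishes on H, but only its values on the factor G matter.\<close>

lemma left_orderable_sign_fun_inl:
  assumes "left_orderable G"
  shows "\<exists>\<sigma>. sign_fun (free_product G H) \<sigma> \<and>
           (\<forall>a\<in>fp_inl G ` carrier G. a \<noteq> \<one>\<^bsub>free_product G H\<^esub> \<longrightarrow> \<sigma> a \<noteq> 0)"
proof -
  obtain \<sigma> where \<sigma>: "sign_fun G \<sigma>" "\<And>g. g \<in> carrier G \<Longrightarrow> g \<noteq> \<one>\<^bsub>G\<^esub> \<Longrightarrow> \<sigma> g \<noteq> 0"
    using G.left_orderable_sign_fun[OF assms] by blast
  have "(\<lambda>a. a) \<in> hom G G" "(\<lambda>_. \<one>\<^bsub>G\<^esub>) \<in> hom H G" by (auto simp: hom_def)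
  then obtain h where h: "h \<in> hom (free_product G H) G" "\<And>a. a \<in> carrier G \<Longrightarrow> h (fp_inl G a) = a"
    using free_product_universal_existence[OF G.is_group] by blast
  interpret h: group_hom "free_product G H" G h
    using h(1) group_free_product G.is_group by (simp add: group_hom_def group_hom_axioms_def)
  have "sign_fun (free_product G H) (\<lambda>w. \<sigma> (h w))"
    using sign_fun_comp[OF h.group_hom_axioms \<sigma>(1)] .
  moreover have "\<sigma> (h a) \<noteq> 0" if a: "a \<in> fp_inl G ` carrier G" "a \<noteq> \<one>\<^bsub>free_product G H\<^esub>" for a
  proof -
    obtain x where x: "x \<in> carrier G" "a = fp_inl G x" using a(1) by blast
    have "x \<noteq> \<one>\<^bsub>G\<^esub>"
      using a(2) unfolding x(2) by (simp add: fp_inl_def free_product_def split: if_splits)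
    then show ?thesis unfolding x(2) h(2)[OF x(1)] by (rule \<sigma>(2)[OF x(1)])
  qed
  ultimately show ?thesis by blast
qed

lemma left_orderable_sign_fun_inr:
  assumes "left_orderable H"
  shows "\<exists>\<sigma>. sign_fun (free_product G H) \<sigma> \<and>
           (\<forall>a\<in>fp_inr H ` carrier H. a \<noteq> \<one>\<^bsub>free_product G H\<^esub> \<longrightarrow> \<sigma> a \<noteq> 0)"
proof -
  obtain \<sigma> where \<sigma>: "sign_fun H \<sigma>" "\<And>g. g \<in> carrier H \<Longrightarrow> g \<noteq> \<one>\<^bsub>H\<^esub> \<Longrightarrow> \<sigma> g \<noteq> 0"
    using H.left_orderable_sign_fun[OF assms] by blast
  have "(\<lambda>a. a) \<in> hom H H" "(\<lambda>_. \<one>\<^bsub>H\<^esub>) \<in> hom G H" by (auto simp: hom_def)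
  then obtain h where h: "h \<in> hom (free_product G H) H" "\<And>a. a \<in> carrier H \<Longrightarrow> h (fp_inr H a) = a"
    using free_product_universal_existence[OF H.is_group] by blast
  interpret h: group_hom "free_product G H" H h
    using h(1) group_free_product H.is_group by (simp add: group_hom_def group_hom_axioms_def)
  have "sign_fun (free_product G H) (\<lambda>w. \<sigma> (h w))"
    using sign_fun_comp[OF h.group_hom_axioms \<sigma>(1)] .
  moreover have "\<sigma> (h a) \<noteq> 0" if a: "a \<in> fp_inr H ` carrier H" "a \<noteq> \<one>\<^bsub>free_product G H\<^esub>" for a
  proof -
    obtain x where x: "x \<in> carrier H" "a = fp_inr H x" using a(1) by blast
    have "x \<noteq> \<one>\<^bsub>H\<^esub>"
      using a(2) unfolding x(2) by (simp add: fp_inr_def free_product_def split: if_splits)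
    then show ?thesis unfolding x(2) h(2)[OF x(1)] by (rule \<sigma>(2)[OF x(1)])
  qed
  ultimately show ?thesis by blast
qed

end

text \<open>Multiplication of words never consults the carriers, so the free product of two
  subgroups consists of literally the same words with the same operations. No embedding has to be
  carried along.\<close>

lemma fp_cons_carrier_update:
  "fp_cons (G\<lparr>carrier := A\<rparr>) (H\<lparr>carrier := B\<rparr>) = fp_cons G H"
proof (intro ext)
  fix x w
  show "fp_cons (G\<lparr>carrier := A\<rparr>) (H\<lparr>carrier := B\<rparr>) x w = fp_cons G H x w"
    by (cases "(G, H, x, w)" rule: fp_cons.cases) auto
qed

lemma free_product_carrier_update [simp]:
  "u \<otimes>\<^bsub>free_product (G\<lparr>carrier := A\<rparr>) (H\<lparr>carrier := B\<rparr>)\<^esub> v = u \<otimes>\<^bsub>free_product G H\<^esub> v"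
  "\<one>\<^bsub>free_product (G\<lparr>carrier := A\<rparr>) (H\<lparr>carrier := B\<rparr>)\<^esub> = \<one>\<^bsub>free_product G H\<^esub>"
  by (simp_all add: free_product_def fp_cons_carrier_update)

lemma mem_free_product_carrier_update:
  assumes "A \<subseteq> carrier G" "B \<subseteq> carrier H"
  shows "w \<in> carrier (free_product (G\<lparr>carrier := A\<rparr>) (H\<lparr>carrier := B\<rparr>)) \<longleftrightarrow>
           w \<in> carrier (free_product G H) \<and> set w \<subseteq> A <+> B"
  using assms by (auto simp: free_product_def reduced_words_def fp_letters_def)

lemma countable_carrier_free_product:
  assumes "countable (carrier G)" "countable (carrier H)"
  shows "countable (carrier (free_product G H))"
proof -
  have "carrier (free_product G H) \<subseteq> lists (carrier G <+> carrier H)"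
    by (auto simp: free_product_def reduced_words_def fp_letters_def)
  then show ?thesis
    using assms by (meson countable_Plus countable_lists countable_subset)
qed

subsection \<open>Compactness and isolated points\<close>

lemma openin_cylinder:
  assumes "finite I" "I \<subseteq> A" and Q: "\<And>f g. (\<And>i. i \<in> I \<Longrightarrow> f i = g i) \<Longrightarrow> Q f \<longleftrightarrow> Q g"
  shows "openin (product_topology (\<lambda>_. discrete_topology D) A) {f \<in> A \<rightarrow>\<^sub>E D. Q f}"
  unfolding openin_product_topology_alt
proof
  fix f assume f: "f \<in> {f \<in> A \<rightarrow>\<^sub>E D. Q f}"
  let ?U = "\<lambda>i. if i \<in> I then {f i} else D"
  have "finite {i \<in> A. ?U i \<noteq> D}"
    by (rule finite_subset[OF _ assms(1)]) auto
  moreover have "Pi\<^sub>E A ?U \<subseteq> {f \<in> A \<rightarrow>\<^sub>E D. Q f}"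
  proof
    fix g assume g: "g \<in> Pi\<^sub>E A ?U"
    have fg: "g i = f i" if "i \<in> I" for i
      using PiE_mem[OF g, of i] assms(2) that by auto
    have "g \<in> A \<rightarrow>\<^sub>E D"
    proof (rule PiE_I)
      fix i assume i: "i \<in> A"
      then have "f i \<in> D" using f by auto
      then show "g i \<in> D" using PiE_mem[OF g i] by (auto split: if_splits)
    qed (use g in auto)
    moreover have "Q g" using Q[of f g] fg f by auto
    ultimately show "g \<in> {f \<in> A \<rightarrow>\<^sub>E D. Q f}" by simp
  qed
  moreover have "f \<in> Pi\<^sub>E A ?U" "\<forall>i\<in>A. openin (discrete_topology D) (?U i)"
    using f by (auto simp: PiE_iff)
  ultimately show "\<exists>U. finite {i \<in> A. U i \<noteq> topspace (discrete_topology D)} \<and>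
      (\<forall>i\<in>A. openin (discrete_topology D) (U i)) \<and> f \<in> Pi\<^sub>E A U \<and> Pi\<^sub>E A U \<subseteq> {f \<in> A \<rightarrow>\<^sub>E D. Q f}"
    by (intro exI[of _ ?U]) simp
qed

lemma closedin_cylinder:
  assumes "finite I" "I \<subseteq> A" and Q: "\<And>f g. (\<And>i. i \<in> I \<Longrightarrow> f i = g i) \<Longrightarrow> Q f \<longleftrightarrow> Q g"
  shows "closedin (product_topology (\<lambda>_. discrete_topology D) A) {f \<in> A \<rightarrow>\<^sub>E D. Q f}"
proof -
  have "(A \<rightarrow>\<^sub>E D) - {f \<in> A \<rightarrow>\<^sub>E D. Q f} = {f \<in> A \<rightarrow>\<^sub>E D. \<not> Q f}" by blast
  moreover have "openin (product_topology (\<lambda>_. discrete_topology D) A) {f \<in> A \<rightarrow>\<^sub>E D. \<not> Q f}"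
    using Q by (intro openin_cylinder[OF assms(1,2)]) blast
  ultimately show ?thesis by (simp add: closedin_def)
qed

lemma compact_space_finite_product:
  "finite D \<Longrightarrow> compact_space (product_topology (\<lambda>_. discrete_topology D) A)"
  by (simp add: compact_space_product_topology compact_space_discrete_topology)

abbreviation sign_space :: "'g set \<Rightarrow> ('g \<Rightarrow> int) topology" where
  "sign_space A \<equiv> product_topology (\<lambda>_. discrete_topology {-1, 0, 1}) A"

text \<open>A single instance of the axioms of \<open>sign_fun\<close>. It reads the coordinates g,
  h and their product, and therefore cuts out a clopen set.\<close>

definition sign_rule :: "('g, 'k) monoid_scheme \<Rightarrow> 'g \<Rightarrow> 'g \<Rightarrow> ('g \<Rightarrow> int) \<Rightarrow> bool" where
  "sign_rule K g h \<phi> \<longleftrightarrow>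
     (g \<otimes>\<^bsub>K\<^esub> h = \<one>\<^bsub>K\<^esub> \<longrightarrow> \<phi> h = - \<phi> g) \<and> (0 \<le> \<phi> g \<longrightarrow> 0 \<le> \<phi> h \<longrightarrow> 0 \<le> \<phi> (g \<otimes>\<^bsub>K\<^esub> h))"

lemma sign_fun_iff_rule:
  "sign_fun K \<phi> \<longleftrightarrow> (\<forall>g\<in>carrier K. \<phi> g \<in> {-1, 0, 1}) \<and>
     (\<forall>g\<in>carrier K. \<forall>h\<in>carrier K. sign_rule K g h \<phi>)"
  by (simp add: sign_fun_def sign_rule_def)

context group
begin

lemma closedin_sign_rule:
  assumes "g \<in> carrier G" "h \<in> carrier G"
  shows "closedin (sign_space (carrier G)) {f \<in> carrier G \<rightarrow>\<^sub>E {-1, 0, 1}. sign_rule G g h f}"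
  by (rule closedin_cylinder[of "{g, h, g \<otimes> h}"]) (use assms in \<open>auto simp: sign_rule_def\<close>)

text \<open>Each rule, and the agreement on S, is a closed condition in a compact space, so the
  finite intersection property applies. Any finite family of rules has its pairs in T \<times> T for
  a finite T. Here \<phi> is any table of desired values on S.\<close>

lemma sign_fun_compactness:
  assumes S: "finite S" "S \<subseteq> carrier G"
    and loc: "\<And>T. finite T \<Longrightarrow> T \<subseteq> carrier G \<Longrightarrow>
      \<exists>\<psi>. \<psi> \<in> carrier G \<rightarrow>\<^sub>E {-1, 0, 1} \<and> (\<forall>x\<in>S. \<psi> x = \<phi> x) \<and> (\<forall>g\<in>T. \<forall>h\<in>T. sign_rule G g h \<psi>)"
  shows "\<exists>\<psi>. \<psi> \<in> extensional (carrier G) \<and> sign_fun G \<psi> \<and> (\<forall>x\<in>S. \<psi> x = \<phi> x)"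
proof -
  let ?E = "carrier G \<rightarrow>\<^sub>E {-1, 0, 1 :: int}"
  define C where "C = (\<lambda>(g, h). {f \<in> ?E. sign_rule G g h f})"
  define D where "D = {f \<in> ?E. \<forall>x\<in>S. f x = \<phi> x}"
  let ?\<U> = "insert D (C ` (carrier G \<times> carrier G))"
  have "closedin (sign_space (carrier G)) D"
    unfolding D_def by (rule closedin_cylinder[OF S]) auto
  then have closed: "\<forall>U\<in>?\<U>. closedin (sign_space (carrier G)) U"
    using closedin_sign_rule by (auto simp: C_def)
  have fip: "\<Inter>\<F> \<noteq> {}" if \<F>: "finite \<F>" "\<F> \<subseteq> ?\<U>" for \<F>
  proof -
    have "finite (\<F> - {D})" "\<F> - {D} \<subseteq> C ` (carrier G \<times> carrier G)" using \<F> by auto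
    then obtain P where P: "P \<subseteq> carrier G \<times> carrier G" "finite P" "\<F> - {D} = C ` P"
      by (meson finite_subset_image)
    have "finite (fst ` P \<union> snd ` P)" "fst ` P \<union> snd ` P \<subseteq> carrier G" using P by auto
    then obtain \<psi> where \<psi>: "\<psi> \<in> ?E" "\<forall>x\<in>S. \<psi> x = \<phi> x"
        "\<forall>g\<in>fst ` P \<union> snd ` P. \<forall>h\<in>fst ` P \<union> snd ` P. sign_rule G g h \<psi>"
      using loc[of "fst ` P \<union> snd ` P"] by auto
    have "\<psi> \<in> C gh" if "gh \<in> P" for gh
      using \<psi>(1,3) imageI[OF that, of fst] imageI[OF that, of snd]
      by (cases gh) (simp add: C_def)
    moreover have "\<psi> \<in> D" using \<psi>(1,2) by (simp add: D_def)
    ultimately have "\<psi> \<in> U" if "U \<in> \<F>" for U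
      using that P(3) by (cases "U = D") blast+
    then show ?thesis by blast
  qed
  have "compact_space (sign_space (carrier G))" by (rule compact_space_finite_product) simp
  moreover have "(\<forall>U\<in>?\<U>. closedin (sign_space (carrier G)) U) \<and>
      (\<forall>\<F>. finite \<F> \<and> \<F> \<subseteq> ?\<U> \<longrightarrow> \<Inter>\<F> \<noteq> {})"
    using closed fip by simp
  ultimately have "\<Inter>?\<U> \<noteq> {}"
    unfolding compact_space_fip by (elim allE impE)
  then obtain \<psi> where "\<psi> \<in> \<Inter>?\<U>" by blast
  then have "\<psi> \<in> D" "\<And>g h. g \<in> carrier G \<Longrightarrow> h \<in> carrier G \<Longrightarrow> \<psi> \<in> C (g, h)" by auto
  then show ?thesis
    by (intro exI[of _ \<psi>]) (auto simp: C_def D_def sign_fun_iff_rule PiE_iff)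
qed

text \<open>A basic neighbourhood constrains finitely many coordinates, so an isolated preorder is
  determined by finitely many of its signs.\<close>

lemma isolated_in_PO:
  assumes iso: "isolated_point_of (PO_space G) \<phi>"
  shows "\<exists>S. finite S \<and> S \<subseteq> carrier G \<and> \<phi> \<in> PO G \<and>
           (\<forall>\<psi>\<in>PO G. (\<forall>x\<in>S. \<psi> x = \<phi> x) \<longrightarrow> \<psi> = \<phi>)"
proof -
  have "openin (PO_space G) {\<phi>}" using iso by (simp add: isolated_point_of_def)
  then obtain V where V: "openin (sign_space (carrier G)) V" "{\<phi>} = V \<inter> PO G"
    by (auto simp: PO_space_def openin_subtopology)
  then obtain U where U: "finite {i \<in> carrier G. U i \<noteq> {-1, 0, 1}}" "\<phi> \<in> Pi\<^sub>E (carrier G) U"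
      "Pi\<^sub>E (carrier G) U \<subseteq> V"
    unfolding openin_product_topology_alt by (metis (no_types, lifting) Int_iff insertI1 topspace_discrete_topology Collect_cong)
  let ?S = "{i \<in> carrier G. U i \<noteq> {-1, 0, 1}}"
  have "\<psi> = \<phi>" if \<psi>: "\<psi> \<in> PO G" "\<forall>x\<in>?S. \<psi> x = \<phi> x" for \<psi>
  proof -
    have "\<psi> \<in> Pi\<^sub>E (carrier G) U"
    proof (rule PiE_I)
      fix i assume i: "i \<in> carrier G"
      show "\<psi> i \<in> U i"
      proof (cases "i \<in> ?S")
        case True
        then show ?thesis using PiE_mem[OF U(2) i] \<psi>(2) by simp
      next
        case False
        then show ?thesis using \<psi>(1) i by (auto simp: PO_iff sign_fun_def)
      qed
    qed (use \<psi>(1) in \<open>auto simp: PO_iff extensional_def\<close>)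
    then show ?thesis using U(3) V(2) \<psi>(1) by blast
  qed
  then show ?thesis using U(1) V(2) by (intro exI[of _ ?S]) auto
qed

end

lemma reduced_words_drop: "w \<in> reduced_words G H \<Longrightarrow> drop n w \<in> reduced_words G H"
proof (induction n arbitrary: w)
  case (Suc n)
  then show ?case by (cases w) (simp_all add: reduced_words_Cons)
qed simp

section \<open>Perturbation in free products, by reduction to countable subgroups\<close>

context group_pair
begin

text \<open>What passes between the free product and that of two subgroups. The last two inclusions
  hold because an element of a factor is a word of at most one letter, and that letter must come
  from the subgroup.\<close>

lemma sub_free_product:
  assumes A: "subgroup A G" and B: "subgroup B H"
  defines "\<Gamma>' \<equiv> free_product (G\<lparr>carrier := A\<rparr>) (H\<lparr>carrier := B\<rparr>)"
  shows "free_pair \<Gamma>' (fp_inl G ` A) (fp_inr H ` B)"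
    and "carrier \<Gamma>' \<subseteq> carrier (free_product G H)"
    and "x \<in> carrier \<Gamma>' \<Longrightarrow> inv\<^bsub>\<Gamma>'\<^esub> x = inv\<^bsub>free_product G H\<^esub> x"
    and "sign_fun (free_product G H) \<sigma> \<Longrightarrow> sign_fun \<Gamma>' \<sigma>"
    and "fp_inl G ` carrier G \<inter> carrier \<Gamma>' \<subseteq> fp_inl G ` A"
    and "fp_inr H ` carrier H \<inter> carrier \<Gamma>' \<subseteq> fp_inr H ` B"
proof -
  interpret P: group_pair "G\<lparr>carrier := A\<rparr>" "H\<lparr>carrier := B\<rparr>"
    using A B by (simp add: group_pair_def G.subgroup_imp_group H.subgroup_imp_group)
  have inl: "fp_inl (G\<lparr>carrier := A\<rparr>) = fp_inl G" "fp_inr (H\<lparr>carrier := B\<rparr>) = fp_inr H"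
    by (auto simp: fp_inl_def fp_inr_def fun_eq_iff)
  show "free_pair \<Gamma>' (fp_inl G ` A) (fp_inr H ` B)"
    using P.free_pair_free_product by (simp add: \<Gamma>'_def inl)
  have AB: "A \<subseteq> carrier G" "B \<subseteq> carrier H"
    using A B by (simp_all add: subgroup.subset)
  note mem = mem_free_product_carrier_update[OF AB, folded \<Gamma>'_def]
  show sub: "carrier \<Gamma>' \<subseteq> carrier (free_product G H)" using mem by blast
  interpret \<Gamma>': group \<Gamma>' unfolding \<Gamma>'_def by (rule P.group_free_product)
  interpret \<Gamma>: group "free_product G H" by (rule group_free_product)
  have mult: "u \<otimes>\<^bsub>\<Gamma>'\<^esub> v = u \<otimes>\<^bsub>free_product G H\<^esub> v" "\<one>\<^bsub>\<Gamma>'\<^esub> = \<one>\<^bsub>free_product G H\<^esub>" for u v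
    by (simp_all add: \<Gamma>'_def)
  show "inv\<^bsub>\<Gamma>'\<^esub> x = inv\<^bsub>free_product G H\<^esub> x" if x: "x \<in> carrier \<Gamma>'"
  proof (rule \<Gamma>.inv_equality[symmetric])
    show "inv\<^bsub>\<Gamma>'\<^esub> x \<otimes>\<^bsub>free_product G H\<^esub> x = \<one>\<^bsub>free_product G H\<^esub>"
      using \<Gamma>'.l_inv[OF x] by (simp add: mult)
  qed (use x sub in auto)
  show "sign_fun \<Gamma>' \<sigma>" if "sign_fun (free_product G H) \<sigma>"
    using that sub by (auto simp: sign_fun_def mult subset_iff)
  show "fp_inl G ` carrier G \<inter> carrier \<Gamma>' \<subseteq> fp_inl G ` A"
  proof
    fix w assume "w \<in> fp_inl G ` carrier G \<inter> carrier \<Gamma>'"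
    then obtain a where a: "a \<in> carrier G" "w = fp_inl G a" "set w \<subseteq> A <+> B" using mem by blast
    then have "a \<in> A"
      using subgroup.one_closed[OF A] by (auto simp: fp_inl_def split: if_splits)
    then show "w \<in> fp_inl G ` A" using a by blast
  qed
  show "fp_inr H ` carrier H \<inter> carrier \<Gamma>' \<subseteq> fp_inr H ` B"
  proof
    fix w assume "w \<in> fp_inr H ` carrier H \<inter> carrier \<Gamma>'"
    then obtain a where a: "a \<in> carrier H" "w = fp_inr H a" "set w \<subseteq> A <+> B" using mem by blast
    then have "a \<in> B"
      using subgroup.one_closed[OF B] by (auto simp: fp_inr_def split: if_splits)
    then show "w \<in> fp_inr H ` B" using a by blast
  qed
qed

text \<open>Only finitely many letters occur in W, and the subgroups they generate in the two
  factors are countable.\<close>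

lemma ex_countable_subgroups:
  assumes "finite W" "W \<subseteq> carrier (free_product G H)"
  shows "\<exists>A B. subgroup A G \<and> subgroup B H \<and> countable A \<and> countable B \<and>
           W \<subseteq> carrier (free_product (G\<lparr>carrier := A\<rparr>) (H\<lparr>carrier := B\<rparr>))"
proof -
  define L where "L = (\<Union>w\<in>W. set w)"
  have "L \<subseteq> fp_letters G H"
    using assms(2) by (auto simp: L_def free_product_def reduced_words_def)
  then have "Inl -` L \<subseteq> carrier G" "Inr -` L \<subseteq> carrier H" by (auto simp: subset_iff)
  moreover have "finite L" using assms(1) by (simp add: L_def)
  then have "finite (Inl -` L)" "finite (Inr -` L)"
    by (auto intro: finite_vimageI)
  moreover have "L \<subseteq> generate G (Inl -` L) <+> generate H (Inr -` L)"
  proof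
    fix x assume "x \<in> L"
    then show "x \<in> generate G (Inl -` L) <+> generate H (Inr -` L)"
      by (cases x) (auto intro: generate.incl)
  qed
  then have "set w \<subseteq> generate G (Inl -` L) <+> generate H (Inr -` L)" if "w \<in> W" for w
    using that by (auto simp: L_def)
  ultimately show ?thesis
    using assms(2)
    by (intro exI[of _ "generate G (Inl -` L)"] exI[of _ "generate H (Inr -` L)"])
      (auto simp: mem_free_product_carrier_update G.generate_incl H.generate_incl
        G.generate_is_subgroup H.generate_is_subgroup G.countable_generate H.countable_generate
        countable_finite)
qed

text \<open>The data m, k, b and \<sigma> are chosen once, in the full product. Hence the word t and
  its new sign do not depend on the countable subgroups used for a finite set T, and compactness can
  combine the local solutions.\<close>

lemma ex_perturbation:
  assumes "carrier G \<noteq> {\<one>\<^bsub>G\<^esub>}" "carrier H \<noteq> {\<one>\<^bsub>H\<^esub>}" "left_orderable G" "left_orderable H"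
    and \<phi>: "sign_fun (free_product G H) \<phi>" "g \<in> carrier (free_product G H)" "\<phi> g \<noteq> 0"
    and S: "finite S" "S \<subseteq> carrier (free_product G H)"
  shows "\<exists>\<psi> t. \<psi> \<in> extensional (carrier (free_product G H)) \<and> sign_fun (free_product G H) \<psi> \<and>
           (\<forall>x\<in>S. \<psi> x = \<phi> x) \<and> t \<in> carrier (free_product G H) \<and> \<psi> t \<noteq> \<phi> t"
proof -
  let ?\<Gamma> = "free_product G H"
  let ?A = "fp_inl G ` carrier G" and ?B = "fp_inr H ` carrier H"
  interpret \<Gamma>: free_pair ?\<Gamma> ?A ?B by (rule free_pair_free_product)
  have one: "\<one>\<^bsub>?\<Gamma>\<^esub> = []" by (simp add: free_product_def)
  \<comment> \<open>All suffixes of words in S, from the word itself to the empty word; the latter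
    is inserted separately so that the identity is present even if S is empty.\<close>
  define F where "F = insert [] (\<Union>w\<in>S. (\<lambda>n. drop n w) ` {..length w})"
  have F: "finite F" "F \<noteq> {}" "[] \<in> F" using S by (auto simp: F_def)
  have "w \<in> (\<lambda>n. drop n w) ` {..length w}" for w :: "('a + 'b) list"
    by (rule image_eqI[of _ _ 0]) auto
  then have S_sub: "S \<subseteq> F" by (auto simp: F_def)
  have F_sub: "F \<subseteq> carrier ?\<Gamma>"
    using S(2) reduced_words_drop[of _ G H] by (auto simp: F_def free_product_def)
  have chain: "\<exists>s\<in>?A \<union> ?B. \<exists>y\<in>F. x = s \<otimes>\<^bsub>?\<Gamma>\<^esub> y \<and> length y < length x"
    if x: "x \<in> F" "x \<noteq> []" for x
  proof -
    obtain w n where w: "w \<in> S" "x = drop n w" "n \<le> length w" using x by (auto simp: F_def)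
    obtain a u where au: "x = a # u" using x by (cases x) auto
    then have "u = drop (Suc n) w" using w by (metis drop_Suc list.sel(3) tl_drop)
    moreover have "Suc n \<le> length w" using w au by (metis Suc_leI drop_eq_Nil le_antisym le_neq_implies_less list.distinct(1))
    ultimately have "u \<in> F" using w unfolding F_def by blast
    have red: "a # u \<in> reduced_words G H" using x F_sub au by (auto simp: free_product_def)
    then have "[a] \<in> ?A \<union> ?B" using fp_letter_mem by (auto simp: reduced_words_Cons)
    then show ?thesis using fp_letter_mult[OF red] \<open>u \<in> F\<close> au by (metis length_Cons lessI)
  qed
  obtain \<sigma>A where \<sigma>A: "sign_fun ?\<Gamma> \<sigma>A" "\<forall>a\<in>?A. a \<noteq> \<one>\<^bsub>?\<Gamma>\<^esub> \<longrightarrow> \<sigma>A a \<noteq> 0"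
    using left_orderable_sign_fun_inl[OF assms(3)] by (elim exE conjE) (rule that)
  obtain \<sigma>B where \<sigma>B: "sign_fun ?\<Gamma> \<sigma>B" "\<forall>b\<in>?B. b \<noteq> \<one>\<^bsub>?\<Gamma>\<^esub> \<longrightarrow> \<sigma>B b \<noteq> 0"
    using left_orderable_sign_fun_inr[OF assms(4)] by (elim exE conjE) (rule that)
  have "?A \<noteq> {\<one>\<^bsub>?\<Gamma>\<^esub>}"
  proof -
    obtain a where "a \<in> carrier G" "a \<noteq> \<one>\<^bsub>G\<^esub>" using assms(1) G.one_closed by blast
    then have "[Inl a] \<in> ?A" by (auto simp: fp_inl_def image_iff)
    then show ?thesis using one by auto
  qed
  moreover have "?B \<noteq> {\<one>\<^bsub>?\<Gamma>\<^esub>}"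
  proof -
    obtain a where "a \<in> carrier H" "a \<noteq> \<one>\<^bsub>H\<^esub>" using assms(2) H.one_closed by blast
    then have "[Inr a] \<in> ?B" by (auto simp: fp_inr_def image_iff)
    then show ?thesis using one by auto
  qed
  ultimately obtain m k b \<sigma> where m: "m \<in> F" and kb: "k \<in> ?A \<and> b \<in> ?B \<or> k \<in> ?B \<and> b \<in> ?A"
    and \<sigma>': "sign_fun ?\<Gamma> \<sigma>"
    and top: "\<forall>x\<in>F. \<phi> (inv\<^bsub>?\<Gamma>\<^esub> x \<otimes>\<^bsub>?\<Gamma>\<^esub> (k \<otimes>\<^bsub>?\<Gamma>\<^esub> m)) = 1"
    and neq: "\<phi> (inv\<^bsub>?\<Gamma>\<^esub> (k \<otimes>\<^bsub>?\<Gamma>\<^esub> m) \<otimes>\<^bsub>?\<Gamma>\<^esub> b \<otimes>\<^bsub>?\<Gamma>\<^esub> (k \<otimes>\<^bsub>?\<Gamma>\<^esub> m)) \<noteq> \<sigma> b"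
    using \<Gamma>.flexible_element[OF \<phi> F(1,2) F_sub \<sigma>A(1) bspec[OF \<sigma>A(2), THEN mp] _ \<sigma>B(1) bspec[OF \<sigma>B(2), THEN mp]]
    by blast
  define t where "t = inv\<^bsub>?\<Gamma>\<^esub> (k \<otimes>\<^bsub>?\<Gamma>\<^esub> m) \<otimes>\<^bsub>?\<Gamma>\<^esub> b \<otimes>\<^bsub>?\<Gamma>\<^esub> (k \<otimes>\<^bsub>?\<Gamma>\<^esub> m)"
  have kbm: "k \<in> carrier ?\<Gamma>" "b \<in> carrier ?\<Gamma>" "m \<in> carrier ?\<Gamma>"
    using kb \<Gamma>.A_subset \<Gamma>.B_subset m F_sub by blast+
  then have t: "t \<in> carrier ?\<Gamma>" by (simp add: t_def)
  \<comment> \<open>That t avoids F is itself a consequence of a local solution, which agrees with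
    \<phi> on F and differs from it at t. It ensures that the update at t leaves the values on F
    alone.\<close>
  have loc: "t \<notin> F \<and> (\<exists>\<psi>. \<psi> \<in> carrier ?\<Gamma> \<rightarrow>\<^sub>E {-1, 0, 1} \<and> (\<forall>x\<in>insert t F. \<psi> x = (\<phi>(t := \<sigma> b)) x) \<and>
      (\<forall>g\<in>T. \<forall>h\<in>T. sign_rule ?\<Gamma> g h \<psi>))" if T: "finite T" "T \<subseteq> carrier ?\<Gamma>" for T
  proof -
    have "finite (T \<union> F \<union> {k, b})" "T \<union> F \<union> {k, b} \<subseteq> carrier ?\<Gamma>"
      using T F F_sub kbm by auto
    then obtain A B where AB: "subgroup A G" "subgroup B H" "countable A" "countable B"
      and sub: "T \<union> F \<union> {k, b} \<subseteq> carrier (free_product (G\<lparr>carrier := A\<rparr>) (H\<lparr>carrier := B\<rparr>))"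
      using ex_countable_subgroups by meson
    let ?\<Gamma>' = "free_product (G\<lparr>carrier := A\<rparr>) (H\<lparr>carrier := B\<rparr>)"
    note S = sub_free_product[OF AB(1,2)]
    interpret \<Gamma>': free_pair ?\<Gamma>' "fp_inl G ` A" "fp_inr H ` B" by (rule S(1))
    have cnt: "countable (carrier ?\<Gamma>')"
      using AB by (intro countable_carrier_free_product) auto
    \<comment> \<open>Renames the two factors so that k lies in the first and b in the second, as
      \<open>perturbation\<close> expects.\<close>
    obtain A' B' where fp: "free_pair ?\<Gamma>' A' B'" "k \<in> A'" "b \<in> B'"
      and AB': "A' \<union> B' = fp_inl G ` A \<union> fp_inr H ` B"
    proof (cases "k \<in> ?A \<and> b \<in> ?B")
      case True
      then show ?thesis using S(5,6) sub by (intro that[OF \<Gamma>'.free_pair_axioms]) auto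
    next
      case False
      then show ?thesis using kb S(5,6) sub by (intro that[OF \<Gamma>'.swap]) auto
    qed
    have gens: "fp_inl G ` A \<union> fp_inr H ` B \<supseteq> (?A \<union> ?B) \<inter> carrier ?\<Gamma>'"
      using S(5,6) by blast
    have chain': "\<exists>s\<in>A' \<union> B'. \<exists>y\<in>F. x = s \<otimes>\<^bsub>?\<Gamma>'\<^esub> y \<and> length y < length x"
      if x: "x \<in> F" "x \<noteq> \<one>\<^bsub>?\<Gamma>'\<^esub>" for x
    proof -
      obtain s y where s: "s \<in> ?A \<union> ?B" "y \<in> F" "x = s \<otimes>\<^bsub>?\<Gamma>\<^esub> y" "length y < length x"
        using chain[of x] x one by auto
      have sc: "s \<in> carrier ?\<Gamma>" "y \<in> carrier ?\<Gamma>" "y \<in> carrier ?\<Gamma>'" "x \<in> carrier ?\<Gamma>'"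
        using s \<Gamma>.A_subset \<Gamma>.B_subset F_sub sub x by auto
      \<comment> \<open>The letter s of the large product is recovered as a quotient of two elements
        of F, hence lies in the small product, and so comes from one of the subgroups.\<close>
      have "s = x \<otimes>\<^bsub>?\<Gamma>\<^esub> inv\<^bsub>?\<Gamma>\<^esub> y"
        using s sc by (simp add: \<Gamma>.m_assoc)
      also have "\<dots> = x \<otimes>\<^bsub>?\<Gamma>'\<^esub> inv\<^bsub>?\<Gamma>'\<^esub> y" using S(3)[OF sc(3)] by simp
      also have "\<dots> \<in> carrier ?\<Gamma>'"
        by (rule \<Gamma>'.m_closed[OF sc(4) \<Gamma>'.inv_closed[OF sc(3)]])
      finally have "s \<in> A' \<union> B'" using s(1) gens AB' by blast
      then show ?thesis using s by auto
    qed
    have top': "\<phi> (inv\<^bsub>?\<Gamma>'\<^esub> x \<otimes>\<^bsub>?\<Gamma>'\<^esub> (k \<otimes>\<^bsub>?\<Gamma>'\<^esub> m)) = 1" if "x \<in> F" for x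
      using that top sub S(3)[of x] by auto
    obtain \<psi> where \<psi>: "sign_fun ?\<Gamma>' \<psi>" "\<forall>x\<in>F. \<psi> x = \<phi> x"
        "\<psi> (inv\<^bsub>?\<Gamma>'\<^esub> (k \<otimes>\<^bsub>?\<Gamma>'\<^esub> m) \<otimes>\<^bsub>?\<Gamma>'\<^esub> b \<otimes>\<^bsub>?\<Gamma>'\<^esub> (k \<otimes>\<^bsub>?\<Gamma>'\<^esub> m)) = \<sigma> b"
      using free_pair.perturbation[OF fp(1) cnt S(4)[OF \<phi>(1)] S(4)[OF \<sigma>'] F(1) _ _ chain' m fp(2,3) top']
        F(3) sub one by auto
    have km: "k \<otimes>\<^bsub>?\<Gamma>\<^esub> m \<in> carrier ?\<Gamma>'"
      using \<Gamma>'.m_closed[of k m] sub m by auto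
    have t_eq: "inv\<^bsub>?\<Gamma>'\<^esub> (k \<otimes>\<^bsub>?\<Gamma>'\<^esub> m) \<otimes>\<^bsub>?\<Gamma>'\<^esub> b \<otimes>\<^bsub>?\<Gamma>'\<^esub> (k \<otimes>\<^bsub>?\<Gamma>'\<^esub> m) = t"
      using S(3)[OF km] by (simp add: t_def)
    have "inv\<^bsub>?\<Gamma>'\<^esub> (k \<otimes>\<^bsub>?\<Gamma>'\<^esub> m) \<otimes>\<^bsub>?\<Gamma>'\<^esub> b \<otimes>\<^bsub>?\<Gamma>'\<^esub> (k \<otimes>\<^bsub>?\<Gamma>'\<^esub> m) \<in> carrier ?\<Gamma>'"
      by (intro \<Gamma>'.m_closed \<Gamma>'.inv_closed) (use sub m in auto)
    then have t': "t \<in> carrier ?\<Gamma>'" unfolding t_eq .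
    have \<psi>t: "\<psi> t = \<sigma> b" using \<psi>(3) unfolding t_eq .
    \<comment> \<open>The value 0 outside the small product is arbitrary: the rules are required for
      pairs from T only, whose products stay in the small product.\<close>
    define \<psi>' where "\<psi>' = (\<lambda>x\<in>carrier ?\<Gamma>. if x \<in> carrier ?\<Gamma>' then \<psi> x else 0)"
    have \<psi>': "\<psi>' x = \<psi> x" if "x \<in> carrier ?\<Gamma>'" for x
      using that S(2) by (auto simp: \<psi>'_def)
    have "\<psi>' \<in> carrier ?\<Gamma> \<rightarrow>\<^sub>E {-1, 0, 1}"
      using \<psi>(1) by (auto simp: \<psi>'_def sign_fun_def)
    moreover have "t \<notin> F" using \<psi>(2) \<psi>t neq by (auto simp: t_def)
    moreover have "\<psi>' x = (\<phi>(t := \<sigma> b)) x" if "x \<in> insert t F" for x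
      using that \<psi>(2) \<psi>t \<psi>' t' sub by auto
    moreover have "sign_rule ?\<Gamma> g h \<psi>'" if "g \<in> T" "h \<in> T" for g h
    proof -
      have gh: "g \<in> carrier ?\<Gamma>'" "h \<in> carrier ?\<Gamma>'" using that sub by auto
      then have "g \<otimes>\<^bsub>?\<Gamma>\<^esub> h \<in> carrier ?\<Gamma>'" using \<Gamma>'.m_closed[of g h] by simp
      moreover have "sign_rule ?\<Gamma>' g h \<psi>" using \<psi>(1) gh by (auto simp: sign_fun_iff_rule)
      ultimately show ?thesis using gh by (simp add: sign_rule_def \<psi>')
    qed
    ultimately show ?thesis by blast
  qed
  obtain \<psi> where \<psi>: "\<psi> \<in> extensional (carrier ?\<Gamma>)" "sign_fun ?\<Gamma> \<psi>"
      "\<forall>x\<in>insert t F. \<psi> x = (\<phi>(t := \<sigma> b)) x"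
    using \<Gamma>.sign_fun_compactness[OF _ _ conjunct2[OF loc]] F(1) F_sub t by auto
  moreover have "t \<notin> F" using loc[of "{}"] by simp
  ultimately show ?thesis
    using t neq S_sub by (intro exI[of _ \<psi>] exI[of _ t]) (auto simp: t_def)
qed

theorem no_isolated_points:
  assumes "carrier G \<noteq> {\<one>\<^bsub>G\<^esub>}" "carrier H \<noteq> {\<one>\<^bsub>H\<^esub>}" "left_orderable G" "left_orderable H"
  shows "\<not> isolated_point_of (PO_space (free_product G H)) \<phi>"
proof
  interpret \<Gamma>: group "free_product G H" by (rule group_free_product)
  assume "isolated_point_of (PO_space (free_product G H)) \<phi>"
  then obtain S where S: "finite S" "S \<subseteq> carrier (free_product G H)" "\<phi> \<in> PO (free_product G H)"
    and iso: "\<And>\<psi>. \<psi> \<in> PO (free_product G H) \<Longrightarrow> (\<And>x. x \<in> S \<Longrightarrow> \<psi> x = \<phi> x) \<Longrightarrow> \<psi> = \<phi>"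
    using \<Gamma>.isolated_in_PO by meson
  obtain g where \<phi>: "sign_fun (free_product G H) \<phi>" "g \<in> carrier (free_product G H)" "\<phi> g \<noteq> 0"
    using S(3) by (auto simp: \<Gamma>.PO_iff)
  \<comment> \<open>Keeping the non-zero sign at g guarantees that the perturbed preorder is
    non-trivial.\<close>
  obtain \<psi> t where \<psi>: "\<psi> \<in> extensional (carrier (free_product G H))" "sign_fun (free_product G H) \<psi>"
    and agree: "\<forall>x\<in>insert g S. \<psi> x = \<phi> x" and "\<psi> t \<noteq> \<phi> t"
    using ex_perturbation[OF assms \<phi>, of "insert g S"] S \<phi>(2) by auto
  have "\<psi> \<in> PO (free_product G H)"
    using \<psi> agree \<phi>(2,3) by (auto simp: \<Gamma>.PO_iff intro!: bexI[of _ g])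
  then have "\<psi> = \<phi>" using iso agree by blast
  then show False using \<open>\<psi> t \<noteq> \<phi> t\<close> by simp
qed

end

subsection \<open>The Cantor set\<close>

abbreviation binary_sequences :: "(nat \<Rightarrow> bool) topology" where
  "binary_sequences \<equiv> product_topology (\<lambda>_. discrete_topology UNIV) UNIV"

text \<open>A Cantor scheme. The sets are indexed by binary words, encoded as an infinite sequence
  of which, by \<open>U_cong\<close>, only the first n entries count.\<close>

locale binary_scheme =
  fixes X :: "'x topology" and U :: "(nat \<Rightarrow> bool) \<Rightarrow> nat \<Rightarrow> 'x set"
  assumes compact: "compact_space X" and Hausdorff: "Hausdorff_space X"
    and U_0: "U b 0 = topspace X"
    and U_closed: "closedin X (U b n)"
    and U_nonempty: "U b n \<noteq> {}"
    and U_split: "U b n = U (b(n := True)) (Suc n) \<union> U (b(n := False)) (Suc n)"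
    and U_disjoint: "U (b(n := True)) (Suc n) \<inter> U (b(n := False)) (Suc n) = {}"
    and U_cong: "(\<And>i. i < n \<Longrightarrow> b i = c i) \<Longrightarrow> U b n = U c n"
    and U_separates: "(\<And>n. x \<in> U b n) \<Longrightarrow> (\<And>n. y \<in> U b n) \<Longrightarrow> x = y"
begin

lemma U_decreasing: "decseq (U b)"
proof (rule decseq_SucI)
  fix n
  have "U b (Suc n) = U (b(n := b n)) (Suc n)" by simp
  also have "\<dots> \<subseteq> U b n" using U_split[of b n] by (cases "b n") auto
  finally show "U b (Suc n) \<subseteq> U b n" .
qed

definition point :: "(nat \<Rightarrow> bool) \<Rightarrow> 'x" where
  "point b = (SOME x. \<forall>n. x \<in> U b n)"

lemma point_mem: "point b \<in> U b n"
proof -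
  have "(\<Inter>n. U b n) \<noteq> {}"
    by (rule compact_space_imp_nest[OF compact U_closed U_nonempty U_decreasing])
  then have "\<exists>x. \<forall>n. x \<in> U b n" by blast
  then show ?thesis unfolding point_def by (rule someI2_ex) blast
qed

lemma point_unique: "(\<And>n. x \<in> U b n) \<Longrightarrow> point b = x"
  using U_separates[of "point b" b x] point_mem by blast

lemma point_inj: "inj point"
proof (rule injI, rule ccontr)
  fix b c assume eq: "point b = point c" and "b \<noteq> c"
  then have ex: "\<exists>n. b n \<noteq> c n" by auto
  define n where "n = (LEAST n. b n \<noteq> c n)"
  have less: "b i = c i" if "i < n" for i
    using not_less_Least[of i "\<lambda>n. b n \<noteq> c n"] that by (auto simp: n_def)
  have neq: "b n \<noteq> c n" using LeastI_ex[OF ex] by (simp add: n_def)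
  have "U c (Suc n) = U (b(n := c n)) (Suc n)"
    using less by (intro U_cong) (auto simp: less_Suc_eq)
  moreover have "U b (Suc n) = U (b(n := b n)) (Suc n)" by simp
  ultimately have "U b (Suc n) \<inter> U c (Suc n) = {}"
    using neq U_disjoint[of b n] by (cases "b n"; cases "c n") auto
  then show False using point_mem[of b "Suc n"] point_mem[of c "Suc n"] eq by auto
qed

lemma point_surj:
  assumes "x \<in> topspace X"
  shows "\<exists>b. point b = x"
proof -
  \<comment> \<open>\<open>f n\<close> holds the first n entries of the address of x; its entries
    from n on are the placeholder True.\<close>
  define f where "f = rec_nat (\<lambda>_. True) (\<lambda>n b. b(n := x \<in> U (b(n := True)) (Suc n)))"
  have f [simp]: "f 0 = (\<lambda>_. True)" "f (Suc n) = (f n)(n := x \<in> U ((f n)(n := True)) (Suc n))" for n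
    by (simp_all add: f_def)
  have fU: "x \<in> U (f n) n" for n
  proof (induction n)
    case 0
    then show ?case using assms by (simp add: U_0)
  next
    case (Suc n)
    show ?case
    proof (cases "x \<in> U ((f n)(n := True)) (Suc n)")
      case True
      then have "f (Suc n) = (f n)(n := True)" by (simp only: f(2))
      then show ?thesis using True by (simp only:)
    next
      case False
      then have "f (Suc n) = (f n)(n := False)" by (simp only: f(2))
      moreover have "x \<in> U ((f n)(n := False)) (Suc n)"
        using Suc False U_split[of "f n" n] by blast
      ultimately show ?thesis by (simp only:)
    qed
  qed
  have stable: "f n i = f (Suc i) i" if "i < n" for n i
    using that by (induction n) (auto simp: less_Suc_eq)
  have "x \<in> U (\<lambda>i. f (Suc i) i) n" for n
    using fU[of n] U_cong[of n "f n" "\<lambda>i. f (Suc i) i"] stable by blast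
  then show ?thesis using point_unique by blast
qed

text \<open>The closed sets U b n - V decrease, and their intersection is empty because
  \<open>point b\<close> is the only point common to all U b n. By compactness one of them is empty,
  so finitely many entries of b already force the image into V.\<close>

lemma point_continuous: "continuous_map binary_sequences X point"
  unfolding continuous_map_def
proof (intro conjI allI impI)
  have "point b \<in> topspace X" for b using point_mem[of b 0] by (simp add: U_0)
  then show "point \<in> topspace binary_sequences \<rightarrow> topspace X" by blast
next
  fix V assume V: "openin X V"
  have "\<exists>T. openin binary_sequences T \<and> b \<in> T \<and> T \<subseteq> {b. point b \<in> V}" if b: "point b \<in> V" for b
  proof -
    have "\<exists>n. U b n - V = {}"
    proof (rule ccontr)
      assume "\<nexists>n. U b n - V = {}"
      then have "U b n - V \<noteq> {}" for n by blast
      moreover have "closedin X (U b n - V)" for n by (intro closedin_diff U_closed V)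
      moreover have "decseq (\<lambda>n. U b n - V)"
        using U_decreasing[of b] unfolding decseq_def by blast
      ultimately have "(\<Inter>n. U b n - V) \<noteq> {}"
        using compact_space_imp_nest[OF compact, of "\<lambda>n. U b n - V"] by blast
      then obtain x where x: "\<And>n. x \<in> U b n" "x \<notin> V" by blast
      then show False using point_unique[of x b] b by blast
    qed
    then obtain n where n: "U b n \<subseteq> V" by blast
    let ?T = "{c \<in> UNIV \<rightarrow>\<^sub>E UNIV. \<forall>i<n. c i = b i}"
    have "openin binary_sequences ?T"
      by (rule openin_cylinder[of "{..<n}"]) auto
    moreover have "point c \<in> V" if "c \<in> ?T" for c
      using point_mem[of c n] U_cong[of n c b] that n by auto
    ultimately show ?thesis by (intro exI[of _ ?T]) auto
  qed
  then show "openin binary_sequences {b \<in> topspace binary_sequences. point b \<in> V}"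
    by (subst openin_subopen) simp
qed

text \<open>A continuous bijection from a compact space onto a Hausdorff space is a
  homeomorphism.\<close>

theorem homeomorphic_binary_sequences: "X homeomorphic_space binary_sequences"
proof -
  have "point ` topspace binary_sequences = topspace X"
    using point_surj point_mem[of _ 0] by (auto simp: U_0)
  then have "homeomorphic_map binary_sequences X point"
    using point_continuous Hausdorff point_inj
    by (intro continuous_imp_homeomorphic_map) (auto simp: compact_space_finite_product)
  then show ?thesis
    using homeomorphic_space homeomorphic_space_sym by blast
qed

end

section \<open>Brouwer's characterization of the Cantor set\<close>

definition splits :: "'x set \<Rightarrow> 'x set \<Rightarrow> bool" where
  "splits B V \<longleftrightarrow> V \<inter> B \<noteq> {} \<and> V - B \<noteq> {}"

lemma splits_mono: "splits B V \<Longrightarrow> V \<subseteq> W \<Longrightarrow> splits B W"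
  by (auto simp: splits_def)

text \<open>A countable family of clopen sets separating points stands for metrizability together
  with total disconnectedness.\<close>

locale perfect_zero_dimensional =
  fixes X :: "'x topology" and B :: "nat \<Rightarrow> 'x set"
  assumes compact: "compact_space X" and Hausdorff: "Hausdorff_space X"
    and nonempty: "topspace X \<noteq> {}"
    and perfect: "\<And>x. \<not> isolated_point_of X x"
    and clopen: "openin X (B k)" "closedin X (B k)"
    and separating: "x \<in> topspace X \<Longrightarrow> y \<in> topspace X \<Longrightarrow> x \<noteq> y \<Longrightarrow> \<exists>k. x \<in> B k \<longleftrightarrow> y \<notin> B k"
begin

text \<open>
  Splitting by the least possible index forces these indices to increase along every branch,
  so that every \<open>B k\<close> is eventually decided.
\<close>

definition index :: "'x set \<Rightarrow> nat" where
  "index V = (LEAST k. splits (B k) V)"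

fun piece :: "(nat \<Rightarrow> bool) \<Rightarrow> nat \<Rightarrow> 'x set" where
  "piece b 0 = topspace X"
| "piece b (Suc n) =
     (let V = piece b n in if b n then V \<inter> B (index V) else V - B (index V))"

text \<open>Without isolated points a non-empty open set has two points, and a set of the family
  that separates them splits it.\<close>

lemma ex_splits:
  assumes V: "openin X V" "V \<noteq> {}"
  shows "\<exists>k. splits (B k) V"
proof -
  obtain x where x: "x \<in> V" using V by blast
  then have xX: "x \<in> topspace X" using openin_subset[OF V(1)] by blast
  have "V \<noteq> {x}" using perfect[of x] V xX by (auto simp: isolated_point_of_def)
  then obtain y where y: "y \<in> V" "y \<noteq> x" using x by blast
  then have "y \<in> topspace X" using openin_subset[OF V(1)] by blast
  then obtain k where "x \<in> B k \<longleftrightarrow> y \<notin> B k" using separating xX y by blast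
  then show ?thesis using x y by (auto simp: splits_def)
qed

lemma splits_index: "openin X V \<Longrightarrow> V \<noteq> {} \<Longrightarrow> splits (B (index V)) V"
  unfolding index_def by (rule LeastI_ex) (rule ex_splits)

lemma piece_clopen: "openin X (piece b n) \<and> closedin X (piece b n) \<and> piece b n \<noteq> {}"
proof (induction n)
  case 0
  then show ?case using nonempty by simp
next
  case (Suc n)
  then have "splits (B (index (piece b n))) (piece b n)" using splits_index by blast
  then show ?case
    using Suc clopen by (auto simp: Let_def splits_def intro!: openin_Int openin_diff closedin_diff)
qed

lemma piece_cong: "(\<And>i. i < n \<Longrightarrow> b i = c i) \<Longrightarrow> piece b n = piece c n"
  by (induction n) (auto simp: Let_def)

text \<open>A set that splits the smaller piece also splits the larger one, so the least index
  cannot drop. It cannot stay either, because the smaller piece lies entirely on one side of the set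
  used last.\<close>

lemma piece_index_less: "index (piece b n) < index (piece b (Suc n))"
proof -
  let ?k = "index (piece b (Suc n))"
  have k: "splits (B ?k) (piece b (Suc n))"
    by (rule splits_index) (use piece_clopen[of b "Suc n"] in blast)+
  have "piece b (Suc n) \<subseteq> piece b n" by (auto simp: Let_def)
  then have "index (piece b n) \<le> ?k"
    unfolding index_def[of "piece b n"] using splits_mono[OF k] by (intro Least_le)
  moreover have "\<not> splits (B (index (piece b n))) (piece b (Suc n))"
    by (auto simp: splits_def Let_def)
  then have "index (piece b n) \<noteq> ?k" using k by metis
  ultimately show ?thesis by simp
qed

text \<open>A set \<open>B k\<close> separating x from y would split every piece on the branch,
  bounding by k the indices that strictly increase.\<close>

lemma piece_separates:
  assumes "\<And>n. x \<in> piece b n" "\<And>n. y \<in> piece b n"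
  shows "x = y"
proof (rule ccontr)
  assume "x \<noteq> y"
  moreover have "x \<in> topspace X" "y \<in> topspace X" using assms[of 0] by auto
  ultimately obtain k where "x \<in> B k \<longleftrightarrow> y \<notin> B k" using separating by blast
  then have "splits (B k) (piece b n)" for n
    using assms[of n] by (auto simp: splits_def)
  then have "index (piece b n) \<le> k" for n
    unfolding index_def by (rule Least_le)
  moreover have "n \<le> index (piece b n)" for n
    by (induction n) (use piece_index_less Suc_le_eq le_less_trans in blast)+
  ultimately show False using not_less_eq_eq by blast
qed

sublocale binary_scheme X piece
proof unfold_locales
  fix b n
  show "closedin X (piece b n)" "piece b n \<noteq> {}" using piece_clopen by auto
  have eq: "piece (b(n := v)) n = piece b n" for v by (rule piece_cong) simp
  show "piece b n = piece (b(n := True)) (Suc n) \<union> piece (b(n := False)) (Suc n)"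
    "piece (b(n := True)) (Suc n) \<inter> piece (b(n := False)) (Suc n) = {}"
    by (auto simp: Let_def eq)
  show "x = y" if "\<And>n. x \<in> piece b n" "\<And>n. y \<in> piece b n" for x y
    by (rule piece_separates[OF that])
  show "piece b n = piece c n" if "\<And>i. i < n \<Longrightarrow> b i = c i" for c
    by (rule piece_cong[OF that])
qed (simp_all add: compact Hausdorff)

end

section \<open>The middle-thirds set as a binary scheme\<close>

definition third :: "bool \<Rightarrow> real \<Rightarrow> real" where
  "third c x = (if c then (x + 2) / 3 else x / 3)"

lemma cantor_stage_bounds: "cantor_stage n \<subseteq> {0..1}"
  by (induction n) auto

lemma cantor_stage_decreasing: "cantor_stage (Suc n) \<subseteq> cantor_stage n"
proof (induction n)
  case (Suc n)
  then show ?case by auto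
qed auto

lemma cantor_stage_compact: "compact (cantor_stage n)"
proof (induction n)
  case (Suc n)
  then show ?case
    by (auto intro!: compact_Un compact_continuous_image continuous_intros)
qed auto

lemma cantor_set_compact: "compact cantor_set"
proof -
  have "closed cantor_set"
    unfolding cantor_set_def using cantor_stage_compact by (intro closed_INT) (auto intro: compact_imp_closed)
  then have "compact (cantor_stage 0 \<inter> cantor_set)"
    by (rule compact_Int_closed[OF cantor_stage_compact])
  moreover have "cantor_stage 0 \<inter> cantor_set = cantor_set"
    unfolding cantor_set_def by blast
  ultimately show ?thesis by (simp only:)
qed

lemma cantor_set_bounds: "x \<in> cantor_set \<Longrightarrow> 0 \<le> x \<and> x \<le> 1"
proof -
  assume "x \<in> cantor_set"
  then have "x \<in> cantor_stage 0" unfolding cantor_set_def by blast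
  then show "0 \<le> x \<and> x \<le> 1" by simp
qed

lemma cantor_set_zero: "0 \<in> cantor_set"
proof -
  have "0 \<in> cantor_stage n" for n
    by (induction n) (auto simp: image_iff)
  then show ?thesis by (simp add: cantor_set_def)
qed

text \<open>At each stage one of 3 x and 3 x - 2 is a preimage of x, but the choice might vary with
  the stage. Comparing x with 1/3 fixes it: one of the two numbers leaves the unit interval and
  hence every stage.\<close>

lemma cantor_set_self_similar: "cantor_set = third True ` cantor_set \<union> third False ` cantor_set"
proof (intro equalityI subsetI)
  fix x assume x: "x \<in> cantor_set"
  have stage: "third False (3 * x) = x" "third True (3 * x - 2) = x" by (auto simp: third_def)
  have cases: "3 * x \<in> cantor_stage n \<or> 3 * x - 2 \<in> cantor_stage n" for n
  proof -
    have "x \<in> cantor_stage (Suc n)" using x by (simp only: cantor_set_def) blast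
    then obtain y where "y \<in> cantor_stage n" "x = y / 3 \<or> x = (y + 2) / 3" by auto
    moreover from this have "3 * x = y \<or> 3 * x - 2 = y" by auto
    ultimately show ?thesis by metis
  qed
  show "x \<in> third True ` cantor_set \<union> third False ` cantor_set"
  proof (cases "x \<le> 1 / 3")
    case True
    then have "3 * x - 2 \<notin> cantor_stage n" for n using cantor_stage_bounds[of n] by auto
    then have "3 * x \<in> cantor_set" using cases by (auto simp: cantor_set_def)
    then show ?thesis using stage by (metis UnI2 imageI)
  next
    case False
    then have "3 * x \<notin> cantor_stage n" for n using cantor_stage_bounds[of n] by auto
    then have "3 * x - 2 \<in> cantor_set" using cases by (auto simp: cantor_set_def)
    then show ?thesis using stage by (metis UnI1 imageI)
  qed
next
  fix x assume "x \<in> third True ` cantor_set \<union> third False ` cantor_set"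
  then have "x \<in> cantor_stage (Suc n)" for n
    by (auto simp: cantor_set_def third_def)
  then have "x \<in> cantor_stage n" for n using cantor_stage_decreasing by blast
  then show "x \<in> cantor_set" by (simp add: cantor_set_def)
qed

text \<open>The first entry of b is the outermost contraction, so the recursion shifts the sequence;
  splitting at entry n then happens in the innermost copy.\<close>

fun cantor_piece :: "(nat \<Rightarrow> bool) \<Rightarrow> nat \<Rightarrow> real set" where
  "cantor_piece b 0 = cantor_set"
| "cantor_piece b (Suc n) = third (b 0) ` cantor_piece (\<lambda>i. b (Suc i)) n"

lemma third_inj: "inj (third c)"
  by (auto simp: third_def inj_def)

lemma cantor_piece_split:
  "cantor_piece b n = cantor_piece (b(n := True)) (Suc n) \<union> cantor_piece (b(n := False)) (Suc n)"
proof (induction n arbitrary: b)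
  case 0
  then show ?case using cantor_set_self_similar by simp
next
  case (Suc n)
  have shift: "(\<lambda>i. (b(Suc n := v)) (Suc i)) = (\<lambda>i. b (Suc i))(n := v)" for v by auto
  show ?case
    using Suc[of "\<lambda>i. b (Suc i)"]
    by (simp only: cantor_piece.simps(2)[of _ "Suc n"] cantor_piece.simps(2)[of b] shift fun_upd_other
        nat.distinct image_Un) simp
qed

lemma cantor_piece_disjoint:
  "cantor_piece (b(n := True)) (Suc n) \<inter> cantor_piece (b(n := False)) (Suc n) = {}"
proof (induction n arbitrary: b)
  case 0
  have "third True x \<noteq> third False y" if "x \<in> cantor_set" "y \<in> cantor_set" for x y
    using cantor_set_bounds[OF that(1)] cantor_set_bounds[OF that(2)] by (simp add: third_def)
  then show ?case by auto
next
  case (Suc n)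
  have shift: "(\<lambda>i. (b(Suc n := v)) (Suc i)) = (\<lambda>i. b (Suc i))(n := v)" for v by auto
  have step: "cantor_piece (b(Suc n := v)) (Suc (Suc n)) =
      third (b 0) ` cantor_piece ((\<lambda>i. b (Suc i))(n := v)) (Suc n)" for v
    by (subst cantor_piece.simps(2)) (simp only: shift fun_upd_other nat.distinct, simp)
  show ?case
    unfolding step image_Int[OF third_inj, symmetric] Suc by simp
qed

lemma cantor_piece_diameter:
  "x \<in> cantor_piece b n \<Longrightarrow> y \<in> cantor_piece b n \<Longrightarrow> \<bar>x - y\<bar> \<le> (1 / 3) ^ n"
proof (induction n arbitrary: b x y)
  case 0
  then show ?case using cantor_set_bounds[of x] cantor_set_bounds[of y] by auto
next
  case (Suc n)
  then obtain u v where uv: "u \<in> cantor_piece (\<lambda>i. b (Suc i)) n" "v \<in> cantor_piece (\<lambda>i. b (Suc i)) n"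
    "x = third (b 0) u" "y = third (b 0) v" by auto
  have "x - y = (u - v) / 3" using uv by (simp add: third_def field_simps)
  then have "\<bar>x - y\<bar> = \<bar>(u - v) / 3\<bar>" by (simp only:)
  also have "\<dots> = \<bar>u - v\<bar> / 3" by (simp only: abs_divide abs_numeral)
  finally have "\<bar>x - y\<bar> = \<bar>u - v\<bar> / 3" .
  then show ?case using Suc.IH[OF uv(1,2)] by simp
qed

lemma cantor_piece_compact: "compact (cantor_piece b n)"
proof (induction n arbitrary: b)
  case (Suc n)
  have "continuous_on S (third c)" for S c
    by (cases c) (auto simp: third_def intro!: continuous_intros)
  then show ?case using Suc by (simp add: compact_continuous_image)
qed (simp add: cantor_set_compact)

lemma cantor_set_homeomorphic: "top_of_set cantor_set homeomorphic_space binary_sequences"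
proof -
  interpret binary_scheme "top_of_set cantor_set" cantor_piece
  proof unfold_locales
    show "compact_space (top_of_set cantor_set)"
      using cantor_set_compact by (simp add: compact_space_subtopology)
    show "Hausdorff_space (top_of_set cantor_set)"
      by (simp add: Hausdorff_space_subtopology)
  next
    fix b n
    show "cantor_piece b 0 = topspace (top_of_set cantor_set)" by simp
    have "cantor_piece b n \<subseteq> cantor_set"
    proof (induction n arbitrary: b)
      case (Suc n)
      have "third (b 0) ` cantor_piece (\<lambda>i. b (Suc i)) n \<subseteq> third (b 0) ` cantor_set"
        using Suc by blast
      also have "\<dots> \<subseteq> cantor_set" using cantor_set_self_similar by (cases "b 0") auto
      finally show ?case by simp
    qed simp
    then show "closedin (top_of_set cantor_set) (cantor_piece b n)"
      using compact_imp_closed[OF cantor_piece_compact] by (simp add: closed_subset)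
    show "cantor_piece b n \<noteq> {}"
      by (induction n arbitrary: b) (use cantor_set_zero in auto)
  next
    fix b c :: "nat \<Rightarrow> bool" and n :: nat
    assume "\<And>i. i < n \<Longrightarrow> b i = c i"
    then show "cantor_piece b n = cantor_piece c n"
    proof (induction n arbitrary: b c)
      case (Suc n)
      have "cantor_piece (\<lambda>i. b (Suc i)) n = cantor_piece (\<lambda>i. c (Suc i)) n"
        by (rule Suc.IH) (simp add: Suc.prems)
      then show ?case using Suc.prems[of 0] by simp
    qed simp
  next
    fix x y :: real and b
    assume *: "\<And>n. x \<in> cantor_piece b n" "\<And>n. y \<in> cantor_piece b n"
    have "(\<lambda>n. (1 / 3 :: real) ^ n) \<longlonglongrightarrow> 0" by (rule LIMSEQ_power_zero) simp
    moreover have "\<bar>x - y\<bar> \<le> (1 / 3) ^ n" for n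
      using cantor_piece_diameter * by blast
    ultimately have "\<bar>x - y\<bar> \<le> 0" by (intro LIMSEQ_le_const) auto
    then show "x = y" by simp
  qed (rule cantor_piece_split cantor_piece_disjoint)+
  show ?thesis by (rule homeomorphic_binary_sequences)
qed

section \<open>Compactness of the space of preorders of a finitely generated group\<close>

context group
begin

text \<open>In general non-triviality is a union of cylinders, an open condition. With a finite
  generating set N it suffices to look for a non-zero sign in N, by
  \<open>ex_moving_generator\<close> at the identity, and the union becomes finite and therefore
  closed.\<close>

lemma closedin_PO:
  assumes N: "finite N" "N \<subseteq> carrier G" "generate G N = carrier G"
  shows "closedin (sign_space (carrier G)) (PO G)"
proof -
  let ?E = "carrier G \<rightarrow>\<^sub>E {-1, 0, 1 :: int}"
  define C where "C = (\<lambda>(g, h). {f \<in> ?E. sign_rule G g h f})"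
  define D where "D = {f \<in> ?E. \<exists>s\<in>N. f s \<noteq> 0}"
  have gen: "\<exists>s\<in>N. \<phi> s \<noteq> 0" if \<phi>: "sign_fun G \<phi>" "g \<in> carrier G" "\<phi> g \<noteq> 0" for \<phi> g
  proof -
    interpret \<phi>: signed_group G \<phi> by unfold_locales fact
    obtain s where "s \<in> N" "\<phi> (inv \<one> \<otimes> s \<otimes> \<one>) \<noteq> 0"
      using \<phi>.ex_moving_generator[OF N(2,3) one_closed \<phi>(2,3)] by blast
    then show ?thesis using N(2) by (intro bexI[of _ s]) (auto simp: subset_iff)
  qed
  have "PO G = \<Inter>(insert D (C ` (carrier G \<times> carrier G)))"
  proof (intro equalityI subsetI)
    fix \<phi> assume "\<phi> \<in> PO G"
    then have \<phi>: "\<phi> \<in> extensional (carrier G)" "sign_fun G \<phi>" "\<exists>g\<in>carrier G. \<phi> g \<noteq> 0"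
      by (auto simp: PO_iff)
    then have E: "\<phi> \<in> ?E" by (auto simp: PiE_iff sign_fun_def)
    then have "\<phi> \<in> D" using gen \<phi> by (auto simp: D_def)
    moreover have "\<phi> \<in> C gh" if "gh \<in> carrier G \<times> carrier G" for gh
      using E \<phi>(2) that by (cases gh) (simp add: C_def sign_fun_iff_rule)
    ultimately show "\<phi> \<in> \<Inter>(insert D (C ` (carrier G \<times> carrier G)))" by blast
  next
    fix \<phi> assume "\<phi> \<in> \<Inter>(insert D (C ` (carrier G \<times> carrier G)))"
    then have D: "\<phi> \<in> D" and C: "\<And>g h. g \<in> carrier G \<Longrightarrow> h \<in> carrier G \<Longrightarrow> \<phi> \<in> C (g, h)" by auto
    have "sign_fun G \<phi>" using D C by (auto simp: sign_fun_iff_rule C_def D_def PiE_iff)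
    then show "\<phi> \<in> PO G" using D N(2) by (auto simp: PO_iff D_def PiE_iff)
  qed
  moreover have "closedin (sign_space (carrier G)) D"
    unfolding D_def by (rule closedin_cylinder[OF N(1,2)]) auto
  then have "closedin (sign_space (carrier G)) K" if "K \<in> insert D (C ` (carrier G \<times> carrier G))" for K
    using closedin_sign_rule that by (auto simp: C_def)
  then have "closedin (sign_space (carrier G)) (\<Inter>(insert D (C ` (carrier G \<times> carrier G))))"
    by (intro closedin_Inter) auto
  ultimately show ?thesis by (simp only:)
qed

theorem PO_space_homeomorphic_cantor_set:
  assumes fin: "finitely_generated G" and cnt: "countable (carrier G)"
    and PO: "PO G \<noteq> {}" and perfect: "\<And>\<phi>. \<not> isolated_point_of (PO_space G) \<phi>"
  shows "PO_space G homeomorphic_space top_of_set cantor_set"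
proof -
  obtain N where N: "finite N" "N \<subseteq> carrier G" "generate G N = carrier G"
    using fin by (auto simp: finitely_generated_def)
  let ?I = "carrier G \<times> {-1, 0, 1 :: int}"
  have I: "countable ?I" "?I \<noteq> {}" using cnt by (auto intro: countable_SIGMA)
  \<comment> \<open>Countably many cylinders, one for each element and possible sign, form the
    separating clopen family.\<close>
  define cyl where "cyl = (\<lambda>(g, v). {\<phi> \<in> PO G. \<phi> g = (v :: int)})"
  have sub: "PO G \<subseteq> carrier G \<rightarrow>\<^sub>E {-1, 0, 1}"
  proof
    show "\<phi> \<in> carrier G \<rightarrow>\<^sub>E {-1, 0, 1}" if "\<phi> \<in> PO G" for \<phi>
      using that by (simp add: PO_iff PiE_iff sign_fun_def)
  qed
  then have top: "topspace (PO_space G) = PO G" by (auto simp: PO_space_def)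
  have clopen: "openin (PO_space G) (cyl (g, v))" "closedin (PO_space G) (cyl (g, v))"
    if g: "g \<in> carrier G" for g v
  proof -
    let ?K = "{f \<in> carrier G \<rightarrow>\<^sub>E {-1, 0, 1 :: int}. f g = v}"
    have "cyl (g, v) = ?K \<inter> PO G" using sub by (auto simp: cyl_def)
    moreover have "openin (sign_space (carrier G)) ?K" "closedin (sign_space (carrier G)) ?K"
      by (rule openin_cylinder[of "{g}"] closedin_cylinder[of "{g}"]; use g in auto)+
    ultimately show "openin (PO_space G) (cyl (g, v))" "closedin (PO_space G) (cyl (g, v))"
      by (auto simp: PO_space_def openin_subtopology closedin_subtopology)
  qed
  interpret perfect_zero_dimensional "PO_space G" "\<lambda>n. cyl (from_nat_into ?I n)"
  proof unfold_locales
    have "compactin (sign_space (carrier G)) (PO G)"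
      by (rule closedin_compact_space[OF compact_space_finite_product closedin_PO[OF N]]) simp
    then show "compact_space (PO_space G)"
      unfolding PO_space_def by (rule compact_space_subtopology)
    show "Hausdorff_space (PO_space G)"
      unfolding PO_space_def by (intro Hausdorff_space_subtopology) (simp add: Hausdorff_space_product_topology)
    show "topspace (PO_space G) \<noteq> {}" using PO top by simp
    show "\<not> isolated_point_of (PO_space G) \<phi>" for \<phi> by (rule perfect)
  next
    fix k
    have "from_nat_into ?I k \<in> ?I" using I by (intro from_nat_into)
    then show "openin (PO_space G) (cyl (from_nat_into ?I k))" "closedin (PO_space G) (cyl (from_nat_into ?I k))"
      using clopen by auto
  next
    fix \<phi> \<psi> assume *: "\<phi> \<in> topspace (PO_space G)" "\<psi> \<in> topspace (PO_space G)" "\<phi> \<noteq> \<psi>"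
    then have E: "\<phi> \<in> carrier G \<rightarrow>\<^sub>E {-1, 0, 1}" "\<psi> \<in> carrier G \<rightarrow>\<^sub>E {-1, 0, 1}"
      using sub unfolding top by blast+
    obtain g where g: "g \<in> carrier G" "\<phi> g \<noteq> \<psi> g"
      using PiE_ext[OF E] *(3) by blast
    then have "(g, \<phi> g) \<in> ?I" using PiE_mem[OF E(1)] by blast
    then obtain k where "from_nat_into ?I k = (g, \<phi> g)"
      using from_nat_into_surj[OF I(1)] by blast
    then show "\<exists>k. \<phi> \<in> cyl (from_nat_into ?I k) \<longleftrightarrow> \<psi> \<notin> cyl (from_nat_into ?I k)"
      using * top g by (intro exI[of _ k]) (auto simp: cyl_def)
  qed
  show ?thesis
    using homeomorphic_binary_sequences cantor_set_homeomorphic homeomorphic_space_sym homeomorphic_space_trans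
    by blast
qed

end

lemma (in group_pair) finitely_generated_free_product:
  assumes "finitely_generated G" "finitely_generated H"
  shows "finitely_generated (free_product G H)"
proof -
  interpret \<Gamma>: free_pair "free_product G H" "fp_inl G ` carrier G" "fp_inr H ` carrier H"
    by (rule free_pair_free_product)
  interpret l: group_hom G "free_product G H" "fp_inl G" using fp_inl_hom by unfold_locales
  interpret r: group_hom H "free_product G H" "fp_inr H" using fp_inr_hom by unfold_locales
  obtain S T where S: "finite S" "S \<subseteq> carrier G" "generate G S = carrier G"
    and T: "finite T" "T \<subseteq> carrier H" "generate H T = carrier H"
    using assms by (auto simp: finitely_generated_def)
  let ?N = "fp_inl G ` S \<union> fp_inr H ` T"
  have sub: "?N \<subseteq> carrier (free_product G H)" using S T l.hom_closed r.hom_closed by blast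
  have "fp_inl G ` carrier G \<subseteq> generate (free_product G H) ?N"
    using l.generate_img[OF S(2)] \<Gamma>.mono_generate[of "fp_inl G ` S" ?N] S(3) by auto
  moreover have "fp_inr H ` carrier H \<subseteq> generate (free_product G H) ?N"
    using r.generate_img[OF T(2)] \<Gamma>.mono_generate[of "fp_inr H ` T" ?N] T(3) by auto
  ultimately have "generate (free_product G H) (fp_inl G ` carrier G \<union> fp_inr H ` carrier H) \<subseteq>
      generate (free_product G H) ?N"
    by (intro \<Gamma>.generate_subgroup_incl[OF Un_least \<Gamma>.generate_is_subgroup[OF sub]])
  then have "carrier (free_product G H) \<subseteq> generate (free_product G H) ?N"
    by (simp only: \<Gamma>.generators)
  then have "generate (free_product G H) ?N = carrier (free_product G H)"
    using \<Gamma>.generate_incl[OF sub] by blast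
  then show ?thesis
    unfolding finitely_generated_def using S(1) T(1) sub by (intro exI[of _ ?N]) auto
qed

lemma (in group) countable_finitely_generated: "finitely_generated G \<Longrightarrow> countable (carrier G)"
  using countable_generate countable_finite by (metis finitely_generated_def)

theorem theorem1p3:
  fixes G :: "('a, 'm) monoid_scheme" and H :: "('b, 'n) monoid_scheme"
  assumes "group G" and "group H"
    and "carrier G \<noteq> {\<one>\<^bsub>G\<^esub>}" and "carrier H \<noteq> {\<one>\<^bsub>H\<^esub>}"
    and "left_orderable G" and "left_orderable H"
  shows "(\<nexists>\<phi>. isolated_point_of (PO_space (free_product G H)) \<phi>) \<and>
         (finitely_generated G \<and> finitely_generated H \<longrightarrow>
            PO_space (free_product G H) homeomorphic_space top_of_set cantor_set)"
proof -
  interpret group_pair G H using assms by (simp add: group_pair_def)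
  interpret \<Gamma>: group "free_product G H" by (rule group_free_product)
  have perfect: "\<not> isolated_point_of (PO_space (free_product G H)) \<phi>" for \<phi>
    by (rule no_isolated_points[OF assms(3-6)])
  \<comment> \<open>The empty space has no isolated points either, so a preorder must be exhibited.
    The left-order of G, pulled back along the retraction onto G, provides one.\<close>
  have "PO (free_product G H) \<noteq> {}"
  proof -
    obtain \<sigma> where \<sigma>: "sign_fun (free_product G H) \<sigma>"
        "\<forall>a\<in>fp_inl G ` carrier G. a \<noteq> \<one>\<^bsub>free_product G H\<^esub> \<longrightarrow> \<sigma> a \<noteq> 0"
      using left_orderable_sign_fun_inl[OF assms(5)] by (elim exE conjE) (rule that)
    obtain a where a: "a \<in> carrier G" "a \<noteq> \<one>\<^bsub>G\<^esub>" using assms(3) G.one_closed by blast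
    have "fp_inl G a \<in> carrier (free_product G H)" by (rule hom_in_carrier[OF fp_inl_hom a(1)])
    moreover have "\<sigma> (fp_inl G a) \<noteq> 0"
      using \<sigma>(2) a by (simp add: fp_inl_def free_product_def)
    ultimately show ?thesis
      using \<Gamma>.sign_fun_preorder(1)[OF \<sigma>(1)] by (auto simp: PO_def)
  qed
  then have "PO_space (free_product G H) homeomorphic_space top_of_set cantor_set"
    if "finitely_generated G" "finitely_generated H"
    using \<Gamma>.PO_space_homeomorphic_cantor_set[OF finitely_generated_free_product[OF that]
        countable_carrier_free_product _ perfect]
      G.countable_finitely_generated[OF that(1)] H.countable_finitely_generated[OF that(2)]
    by blast
  then show ?thesis using perfect by blast
qed

end
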